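(* Let $p_0,p_1\in(0,\infty)$ and let $w_0,w_1$ be weights on $(0,\infty)$. Define $\psi_0,\psi_1\colon(0,\infty)\to[0,\infty]$ by $$\psi_i(t)=\left(\int_t^\infty s^{-p_i}w_i(s)\,ds\right)^{\frac1{p_i}}\quad\text{for }t\in(0,\infty),\ i\in\{0,1\}.$$ Suppose that $\psi_i(0+)=\infty$ for $i\in\{0,1\}$; that there exists a positive constant $C$ such that $\psi_i(t)\le C\psi_i(2t)$ for all $t\in(0,\infty)$ and $i\in\{0,1\}$; and that $w_0\in\mathrm{RB}_{p_0}$, that is, there exists a positive constant $C'$ such that $$\int_0^t w_0(s)\,ds\le C'\,t^{p_0}\int_t^\infty\frac{w_0(s)}{s^{p_0}}\,ds\quad\text{for all }t\in(0,\infty).$$ Let $$\theta(t)=\frac{\psi_0(t)}{\psi_1(t)}\quad\text{for }t\in(0,\infty),$$ and assume that there exists $\varepsilon>0$ such that the function $t\mapsto\theta(t)\,\psi_0(t)^{\varepsilon}$ is equivalent to a non-decreasing function on $(0,\infty)$. Then $$K\big(f,\theta(t);S^{p_0}(w_0),S^{p_1}(w_1)\big)\approx\left(\int_0^t(f^{**}(s)-f^*(s))^{p_0}w_0(s)\,ds\right)^{\frac1{p_0}}+\theta(t)\left(\int_t^\infty(f^{**}(s)-f^*(s))^{p_1}w_1(s)\,ds\right)^{\frac1{p_1}}$$ for all $f\in S^{p_0}(w_0)+S^{p_1}(w_1)$ and $t\in(0,\infty)$, with constants in the relation $\approx$ independent of $f$ and $t$.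
   Context: $(\mathcal R,\mu)$ is a nonatomic $\sigma$-finite measure space with $\mu(\mathcal R)\in(0,\infty]$, over which the spaces below are considered. A weight on $(0,\infty)$ is a nonnegative measurable function on $(0,\infty)$. The non-increasing rearrangement of a measurable $f$ is $f^*(t)=\inf\{\lambda\ge0:\mu(\{|f|>\lambda\})\le t\}$, and $f^{**}(t)=\frac1t\int_0^tf^*(s)\,ds$. For $p\in(0,\infty)$ and a weight $w$, $\|f\|_{S^p(w)}=\left(\int_0^\infty(f^{**}(t)-f^*(t))^pw(t)\,dt\right)^{1/p}$, and $S^p(w)$ is the set of measurable $f$ on $\mathcal R$ with $\|f\|_{S^p(w)}<\infty$ and $\lim_{t\to\infty}f^*(t)=0$ (this functional need not be a quasinorm and the set need not be linear). $S^{p_0}(w_0)+S^{p_1}(w_1)$ is the set of $f$ that can be written as $f=f_0+f_1$ with $f_i\in S^{p_i}(w_i)$, and $K(f,t;X_0,X_1)=\inf\{\|f_0\|_{X_0}+t\|f_1\|_{X_1}: f=f_0+f_1,\ f_i\in X_i\}$. Two nonnegative functions are equivalent if each is bounded by a constant multiple of the other; $\approx$ has the same meaning for expressions.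
   Formalization: It is additionally assumed that ψ₁(t)<∞ for all t>0; otherwise ψ₁≡∞ by doubling, and θ is ∞/∞ or 0, where the claim is false (e.g. p₀=2, w₀=1, p₁=1, w₁(s)=s, f an indicator function). *)

theory Defs
  imports "HOL-Analysis.Analysis"
begin

definition nonatomic :: "'a measure \<Rightarrow> bool" where
  "nonatomic M \<longleftrightarrow> (\<forall>A\<in>sets M. 0 < emeasure M A \<longrightarrow>
     (\<exists>B\<in>sets M. B \<subseteq> A \<and> 0 < emeasure M B \<and> emeasure M B < emeasure M A))"

text \<open>Powers of extended nonnegative reals; used only with exponent \<open>a > 0\<close>, so that
  \<open>0\<close> and \<open>\<infinity>\<close> are mapped to themselves.\<close>
definition enn_powr :: "ennreal \<Rightarrow> real \<Rightarrow> ennreal" where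
  "enn_powr x a = (if x = top then top else ennreal (enn2real x powr a))"

text \<open>A weight on \<open>(0, \<infinity>)\<close>; values outside \<open>(0, \<infinity>)\<close> are never used, and the value
  \<open>\<infinity>\<close> is permitted.\<close>
definition weight :: "(real \<Rightarrow> ennreal) \<Rightarrow> bool" where
  "weight w \<longleftrightarrow> w \<in> borel_measurable (lebesgue_on {0<..})"

text \<open>The infimum is taken in \<open>[0, \<infinity>]\<close>, so it is \<open>\<infinity>\<close> over the empty set.\<close>
definition rearrangement :: "'a measure \<Rightarrow> ('a \<Rightarrow> real) \<Rightarrow> real \<Rightarrow> ennreal" where
  "rearrangement M f t =
     Inf {ennreal l | l. 0 \<le> l \<and> emeasure M {x \<in> space M. l < \<bar>f x\<bar>} \<le> ennreal t}"

definition max_rearrangement :: "'a measure \<Rightarrow> ('a \<Rightarrow> real) \<Rightarrow> real \<Rightarrow> ennreal" where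
  "max_rearrangement M f t =
     (\<integral>\<^sup>+ s \<in> {0<..<t}. rearrangement M f s \<partial>lebesgue) / ennreal t"

text \<open>The subtraction is the truncated one of \<open>ennreal\<close>. It is the ordinary difference whenever
  \<open>f\<^sup>*(t) < \<infinity>\<close>, because \<open>f\<^sup>* \<le> f\<^sup>*\<^sup>*\<close>; and \<open>f\<^sup>*\<close> is finite on \<open>(0, \<infinity>)\<close> for every real-valued
  measurable \<open>f\<close> with \<open>f\<^sup>*(\<infinity>) = 0\<close>.\<close>
definition osc :: "'a measure \<Rightarrow> ('a \<Rightarrow> real) \<Rightarrow> real \<Rightarrow> ennreal" where
  "osc M f t = max_rearrangement M f t - rearrangement M f t"

definition S_norm ::
    "'a measure \<Rightarrow> real \<Rightarrow> (real \<Rightarrow> ennreal) \<Rightarrow> ('a \<Rightarrow> real) \<Rightarrow> ennreal" where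
  "S_norm M p w f =
     enn_powr (\<integral>\<^sup>+ t \<in> {0<..}. enn_powr (osc M f t) p * w t \<partial>lebesgue) (1 / p)"

definition S_space :: "'a measure \<Rightarrow> real \<Rightarrow> (real \<Rightarrow> ennreal) \<Rightarrow> ('a \<Rightarrow> real) set" where
  "S_space M p w = {f \<in> borel_measurable M.
     S_norm M p w f < \<infinity> \<and> (rearrangement M f \<longlongrightarrow> 0) at_top}"

definition decomposes ::
    "'a measure \<Rightarrow> ('a \<Rightarrow> real) \<Rightarrow> ('a \<Rightarrow> real) \<Rightarrow> ('a \<Rightarrow> real) \<Rightarrow> bool" where
  "decomposes M f f0 f1 \<longleftrightarrow> (\<forall>x\<in>space M. f x = f0 x + f1 x)"

definition sum_space ::
    "'a measure \<Rightarrow> ('a \<Rightarrow> real) set \<Rightarrow> ('a \<Rightarrow> real) set \<Rightarrow> ('a \<Rightarrow> real) set" where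
  "sum_space M X0 X1 = {f. \<exists>f0\<in>X0. \<exists>f1\<in>X1. decomposes M f f0 f1}"

definition S_K_functional ::
    "'a measure \<Rightarrow> real \<Rightarrow> (real \<Rightarrow> ennreal) \<Rightarrow> real \<Rightarrow> (real \<Rightarrow> ennreal) \<Rightarrow>
      ('a \<Rightarrow> real) \<Rightarrow> ennreal \<Rightarrow> ennreal" where
  "S_K_functional M p0 w0 p1 w1 f t =
     Inf {S_norm M p0 w0 f0 + t * S_norm M p1 w1 f1 | f0 f1.
       f0 \<in> S_space M p0 w0 \<and> f1 \<in> S_space M p1 w1 \<and> decomposes M f f0 f1}"

definition equivalent_on :: "'b set \<Rightarrow> ('b \<Rightarrow> ennreal) \<Rightarrow> ('b \<Rightarrow> ennreal) \<Rightarrow> bool" where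
  "equivalent_on A g h \<longleftrightarrow>
     (\<exists>C::real. C > 0 \<and> (\<forall>x\<in>A. g x \<le> ennreal C * h x \<and> h x \<le> ennreal C * g x))"

definition psi :: "real \<Rightarrow> (real \<Rightarrow> ennreal) \<Rightarrow> real \<Rightarrow> ennreal" where
  "psi p w t = enn_powr (\<integral>\<^sup>+ s \<in> {t<..}. ennreal (s powr (- p)) * w s \<partial>lebesgue) (1 / p)"

definition RB :: "real \<Rightarrow> (real \<Rightarrow> ennreal) \<Rightarrow> bool" where
  "RB p w \<longleftrightarrow> (\<exists>C::real. C > 0 \<and> (\<forall>t>0.
     (\<integral>\<^sup>+ s \<in> {0<..<t}. w s \<partial>lebesgue) \<le>
       ennreal C * ennreal (t powr p) * (\<integral>\<^sup>+ s \<in> {t<..}. w s / ennreal (s powr p) \<partial>lebesgue)))"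

text \<open>In \<open>ennreal\<close> a quotient with denominator \<open>\<infinity>\<close> is \<open>0\<close>, including \<open>\<infinity> / \<infinity>\<close>.\<close>
definition theta ::
    "real \<Rightarrow> (real \<Rightarrow> ennreal) \<Rightarrow> real \<Rightarrow> (real \<Rightarrow> ennreal) \<Rightarrow> real \<Rightarrow> ennreal" where
  "theta p0 w0 p1 w1 t = psi p0 w0 t / psi p1 w1 t"

end

theory Submission
  imports Defs
begin

text \<open>
  Put \<open>G\<^sub>f(t) = t (f\<^sup>*\<^sup>*(t) - f\<^sup>*(t)) = \<integral>\<^sub>0\<^sup>t (f\<^sup>* - f\<^sup>*(t))\<close>, which is nondecreasing in \<open>t\<close>, and
  \<open>d\<nu>\<^sub>i = s\<^bsup>-p\<^sub>i\<^esup> w\<^sub>i(s) ds\<close>. Then \<open>\<parallel>f\<parallel>\<^sub>i\<close> is the norm of \<open>G\<^sub>f\<close> in \<open>L\<^bsup>p\<^sub>i\<^esup>(\<nu>\<^sub>i)\<close>, \<open>\<psi>\<^sub>i\<^bsup>p\<^sub>i\<^esup>\<close> is the tail of \<open>\<nu>\<^sub>i\<close>, and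
  \<open>F \<psi>\<^sub>i \<le> \<parallel>F\<parallel>\<^sub>i\<close> for every nondecreasing \<open>F\<close>.

  For the upper bound, cut \<open>f\<close> at the height \<open>f\<^sup>*(t)\<close>. Then \<open>G\<close> of the upper part is \<open>G\<^sub>f(min s t)\<close>,
  \<open>G\<close> of the lower part vanishes before \<open>t\<close> and is at most \<open>G\<^sub>f\<close> after it, and the remaining term
  \<open>G\<^sub>f(t) \<psi>\<^sub>0(t) = \<theta>(t) G\<^sub>f(t) \<psi>\<^sub>1(t)\<close> is absorbed by the second integral.

  For the lower bound, \<open>G\<^sub>f(t) \<le> 3 N(t) + 2 G\<^bsub>f\<^sub>1\<^esub>(2t)\<close> with \<open>N(t) = \<integral>\<^sub>0\<^sup>t f\<^sub>0\<^sup>*\<close> whenever \<open>f = f\<^sub>0 + f\<^sub>1\<close>. The class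
  \<open>RB\<close> is self-improving, which yields a Hardy inequality bounding \<open>\<parallel>N\<parallel>\<^sub>0\<close> by \<open>\<parallel>f\<^sub>0\<parallel>\<^sub>0\<close>, and doubling
  of \<open>\<psi>\<^sub>1\<close> removes the dilation. What remains is to exchange the two norms for nondecreasing functions:
  since \<open>\<theta> \<psi>\<^sub>0\<^sup>\<epsilon>\<close> is essentially nondecreasing, the norm of \<open>1 / \<psi>\<^sub>1\<close> in \<open>L\<^bsup>p\<^sub>0\<^esup>(\<nu>\<^sub>0)\<close> on \<open>(0, t)\<close> is \<open>O(\<theta>(t))\<close>
  and that of \<open>1 / \<psi>\<^sub>0\<close> in \<open>L\<^bsup>p\<^sub>1\<^esup>(\<nu>\<^sub>1)\<close> on \<open>(t, \<infinity>)\<close> is \<open>O(1 / \<theta>(t))\<close>.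
\<close>

section \<open>Powers of extended nonnegative reals\<close>

lemma power_powr_commute: "(x ^ k) powr p = (x powr p) ^ k" for x p :: real
  by (induction k) (simp_all add: powr_mult)

lemma enn_powr_0 [simp]: "enn_powr 0 p = 0"
  by (simp add: enn_powr_def)

lemma enn_powr_top [simp]: "enn_powr top p = top"
  by (simp add: enn_powr_def)

lemma enn_powr_ennreal: "0 \<le> a \<Longrightarrow> enn_powr (ennreal a) p = ennreal (a powr p)"
  by (simp add: enn_powr_def)

lemma enn_powr_less_top_iff [simp]: "enn_powr x p < top \<longleftrightarrow> x < top"
  by (simp add: enn_powr_def less_top)

lemma enn_powr_mono: "0 < p \<Longrightarrow> x \<le> y \<Longrightarrow> enn_powr x p \<le> enn_powr y p"
  by (cases x; cases y) (auto simp: enn_powr_def top_unique intro!: powr_mono2)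

lemma enn_powr_mult: "0 < p \<Longrightarrow> enn_powr (x * y) p = enn_powr x p * enn_powr y p"
  by (cases x; cases y)
    (auto simp: enn_powr_def ennreal_mult_top ennreal_top_mult powr_mult ennreal_mult
      ennreal_mult_eq_top_iff enn2real_mult)

lemma enn_powr_powr_inverse [simp]: "0 < p \<Longrightarrow> enn_powr (enn_powr x p) (1 / p) = x"
  by (cases x) (auto simp: enn_powr_def powr_powr)

lemma enn_powr_inverse_powr [simp]: "0 < p \<Longrightarrow> enn_powr (enn_powr x (1 / p)) p = x"
  by (cases x) (auto simp: enn_powr_def powr_powr)

lemma enn_powr_le_iff: "0 < p \<Longrightarrow> enn_powr x p \<le> enn_powr y p \<longleftrightarrow> x \<le> y"
  using enn_powr_mono[of p x y] enn_powr_mono[of "1 / p" "enn_powr x p" "enn_powr y p"] by auto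

lemma enn_powr_inverse_le_iff: "0 < p \<Longrightarrow> enn_powr x (1 / p) \<le> y \<longleftrightarrow> x \<le> enn_powr y p"
  using enn_powr_le_iff[of p "enn_powr x (1 / p)" y] by simp

lemma enn_powr_add_le:
  assumes "0 < p"
  shows "enn_powr (x + y) p \<le> ennreal (2 powr p) * (enn_powr x p + enn_powr y p)"
proof -
  have "enn_powr (x + y) p \<le> enn_powr (ennreal 2 * max x y) p"
    using assms by (intro enn_powr_mono) (auto simp: mult_2 intro!: add_mono)
  also have "\<dots> = ennreal (2 powr p) * enn_powr (max x y) p"
    using assms by (simp only: enn_powr_mult enn_powr_ennreal)
  also have "\<dots> \<le> ennreal (2 powr p) * (enn_powr x p + enn_powr y p)"
    by (intro mult_left_mono) (auto simp: max_def add_increasing)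
  finally show ?thesis .
qed

lemma borel_measurable_enn_powr [measurable (raw)]:
  assumes [measurable]: "f \<in> borel_measurable M"
  shows "(\<lambda>x. enn_powr (f x) p) \<in> borel_measurable M"
  unfolding enn_powr_def by measurable

lemma suminf_ennreal_geometric:
  fixes r :: real
  assumes "0 \<le> r" "r < 1"
  shows "(\<Sum>k. ennreal (r ^ k)) = ennreal (1 / (1 - r))"
  using assms by (intro suminf_ennreal_eq geometric_sums) auto

lemma ennreal_mult_mult: "0 \<le> a \<Longrightarrow> 0 \<le> b \<Longrightarrow> ennreal a * (ennreal b * x) = ennreal (a * b) * x"
  by (simp add: ennreal_mult mult.assoc)

lemma ennreal_mult_mult_cong:
  "0 \<le> a \<Longrightarrow> 0 \<le> b \<Longrightarrow> 0 \<le> c \<Longrightarrow> 0 \<le> d \<Longrightarrow> a * b = c * d \<Longrightarrow>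
    ennreal a * (ennreal b * x) = ennreal c * (ennreal d * x)"
  by (simp only: ennreal_mult_mult)

lemma term_le_suminf_ennreal: "a k \<le> (\<Sum>k. a k)" for a :: "nat \<Rightarrow> ennreal"
  using sum_le_suminf[of a "{k}"] by simp

lemma enn_powr_geometric_suminf_le:
  fixes b :: "nat \<Rightarrow> ennreal" and p \<sigma> :: real
  assumes p_pos: "0 < p" and \<sigma>_bounds: "0 \<le> \<sigma>" "\<sigma> < 1"
  shows "enn_powr (\<Sum>k. ennreal (\<sigma> ^ k) * b k) p \<le>
    enn_powr (ennreal (1 / (1 - \<sigma>))) p * (\<Sum>k. enn_powr (b k) p)"
proof -
  define S where "S = enn_powr (\<Sum>k. enn_powr (b k) p) (1 / p)"
  have "enn_powr (b k) p \<le> enn_powr S p" for k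
    unfolding S_def using p_pos term_le_suminf_ennreal[of "\<lambda>k. enn_powr (b k) p" k] by simp
  then have "b k \<le> S" for k
    using p_pos by (simp add: enn_powr_le_iff)
  then have "(\<Sum>k. ennreal (\<sigma> ^ k) * b k) \<le> (\<Sum>k. ennreal (\<sigma> ^ k) * S)"
    by (intro suminf_le mult_left_mono) auto
  also have "\<dots> = ennreal (1 / (1 - \<sigma>)) * S"
    using suminf_ennreal_geometric[OF \<sigma>_bounds] by simp
  finally have "enn_powr (\<Sum>k. ennreal (\<sigma> ^ k) * b k) p \<le> enn_powr (ennreal (1 / (1 - \<sigma>)) * S) p"
    using p_pos by (intro enn_powr_mono)
  then show ?thesis
    using p_pos by (simp add: enn_powr_mult S_def)
qed

section \<open>Weighted Lebesgue quasinorms\<close>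

definition Lp_norm :: "real \<Rightarrow> 'a measure \<Rightarrow> 'a set \<Rightarrow> ('a \<Rightarrow> ennreal) \<Rightarrow> ennreal" where
  "Lp_norm p M A F = enn_powr (\<integral>\<^sup>+ x \<in> A. enn_powr (F x) p \<partial>M) (1 / p)"

lemma enn_powr_Lp_norm: "0 < p \<Longrightarrow> enn_powr (Lp_norm p M A F) p = (\<integral>\<^sup>+ x \<in> A. enn_powr (F x) p \<partial>M)"
  by (simp add: Lp_norm_def)

lemma Lp_norm_le_iff:
  "0 < p \<Longrightarrow> Lp_norm p M A F \<le> y \<longleftrightarrow> (\<integral>\<^sup>+ x \<in> A. enn_powr (F x) p \<partial>M) \<le> enn_powr y p"
  by (simp add: Lp_norm_def enn_powr_inverse_le_iff)

lemma Lp_norm_le_of_support: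
  assumes "0 < p" "\<And>x. x \<in> A \<Longrightarrow> x \<notin> B \<Longrightarrow> F x = 0" "\<And>x. x \<in> A \<Longrightarrow> x \<in> B \<Longrightarrow> F x \<le> G x"
  shows "Lp_norm p M A F \<le> Lp_norm p M B G"
  unfolding Lp_norm_def using assms
  by (intro enn_powr_mono nn_integral_mono) (auto split: split_indicator intro: enn_powr_mono)

lemma Lp_norm_mono:
  assumes "0 < p" "A \<subseteq> B" "\<And>x. x \<in> A \<Longrightarrow> F x \<le> G x"
  shows "Lp_norm p M A F \<le> Lp_norm p M B G"
  using assms by (intro Lp_norm_le_of_support) auto

lemma Lp_norm_mono_set: "0 < p \<Longrightarrow> A \<subseteq> B \<Longrightarrow> Lp_norm p M A F \<le> Lp_norm p M B F"
  by (rule Lp_norm_mono) auto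

lemma Lp_norm_cmult:
  assumes [measurable]: "F \<in> borel_measurable M" "A \<in> sets M" and "0 < p"
  shows "Lp_norm p M A (\<lambda>x. c * F x) = c * Lp_norm p M A F"
proof -
  have "(\<integral>\<^sup>+ x \<in> A. enn_powr (c * F x) p \<partial>M) = enn_powr c p * (\<integral>\<^sup>+ x \<in> A. enn_powr (F x) p \<partial>M)"
    using \<open>0 < p\<close> by (subst nn_integral_cmult[symmetric]) (simp_all add: enn_powr_mult mult.assoc)
  then show ?thesis
    unfolding Lp_norm_def using \<open>0 < p\<close> by (simp add: enn_powr_mult)
qed

lemma Lp_norm_const:
  assumes "A \<in> sets M" "0 < p"
  shows "Lp_norm p M A (\<lambda>_. c) = c * enn_powr (emeasure M A) (1 / p)"
  using assms by (simp add: Lp_norm_def nn_integral_cmult_indicator enn_powr_mult)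

lemma Lp_norm_add_le:
  assumes [measurable]: "F \<in> borel_measurable M" "G \<in> borel_measurable M" "A \<in> sets M"
    and p_pos: "0 < p"
  shows "Lp_norm p M A (\<lambda>x. F x + G x) \<le>
    ennreal (2 * 2 powr (1 / p)) * (Lp_norm p M A F + Lp_norm p M A G)"
proof -
  let ?I = "\<lambda>F. \<integral>\<^sup>+ x \<in> A. enn_powr (F x) p \<partial>M"
  have "?I (\<lambda>x. F x + G x) \<le> (\<integral>\<^sup>+ x. ennreal (2 powr p) *
      (enn_powr (F x) p * indicator A x + enn_powr (G x) p * indicator A x) \<partial>M)"
    using enn_powr_add_le[OF p_pos] by (intro nn_integral_mono) (auto split: split_indicator)
  also have "\<dots> = ennreal (2 powr p) * (?I F + ?I G)"
    by (simp add: nn_integral_cmult nn_integral_add)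
  finally have "Lp_norm p M A (\<lambda>x. F x + G x) \<le>
      enn_powr (ennreal (2 powr p) * (?I F + ?I G)) (1 / p)"
    unfolding Lp_norm_def using p_pos by (intro enn_powr_mono) auto
  also have "\<dots> = 2 * enn_powr (?I F + ?I G) (1 / p)"
    using p_pos by (simp add: enn_powr_mult enn_powr_ennreal powr_powr)
  also have "\<dots> \<le> 2 * (ennreal (2 powr (1 / p)) * (Lp_norm p M A F + Lp_norm p M A G))"
    unfolding Lp_norm_def using p_pos by (intro mult_left_mono enn_powr_add_le) auto
  finally show ?thesis
    by (simp add: ennreal_mult mult.assoc)
qed

lemma Lp_norm_Un_le:
  assumes [measurable]: "F \<in> borel_measurable M" "A \<in> sets M" "B \<in> sets M" and p_pos: "0 < p"
  shows "Lp_norm p M (A \<union> B) F \<le> ennreal (2 powr (1 / p)) * (Lp_norm p M A F + Lp_norm p M B F)"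
proof -
  let ?I = "\<lambda>A. \<integral>\<^sup>+ x \<in> A. enn_powr (F x) p \<partial>M"
  have "?I (A \<union> B) \<le> (\<integral>\<^sup>+ x. enn_powr (F x) p * indicator A x + enn_powr (F x) p * indicator B x \<partial>M)"
    by (intro nn_integral_mono) (auto split: split_indicator)
  also have "\<dots> = ?I A + ?I B"
    by (rule nn_integral_add) measurable
  finally have "Lp_norm p M (A \<union> B) F \<le> enn_powr (?I A + ?I B) (1 / p)"
    unfolding Lp_norm_def using p_pos by (intro enn_powr_mono) auto
  also have "\<dots> \<le> ennreal (2 powr (1 / p)) * (Lp_norm p M A F + Lp_norm p M B F)"
    unfolding Lp_norm_def using p_pos by (intro enn_powr_add_le) auto
  finally show ?thesis .
qed

text \<open>Splitting off half of the decay replaces the triangle inequality, which fails for \<open>p < 1\<close>.\<close>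

lemma Lp_norm_geometric_suminf_le:
  fixes p \<sigma> :: real and H :: "nat \<Rightarrow> 'a \<Rightarrow> ennreal"
  assumes [measurable]: "\<And>k. H k \<in> borel_measurable M" "A \<in> sets M"
    and p_pos: "0 < p" and \<sigma>_bounds: "0 < \<sigma>" "\<sigma> < 1"
    and Lp_norm_H_le: "\<And>k. Lp_norm p M A (H k) \<le> ennreal (\<sigma> ^ k) * X"
  shows "Lp_norm p M A (\<lambda>x. \<Sum>k. ennreal (\<sigma> ^ k) * H k x) \<le>
    ennreal (1 / (1 - \<sigma>) * (1 / (1 - \<sigma> powr p)) powr (1 / p)) * X"
proof -
  have \<sigma>_powr_bounds: "0 < \<sigma> powr p" "\<sigma> powr p < 1"
    using p_pos \<sigma>_bounds by (auto simp: powr01_less_one)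
  define a b c where "a = 1 / (1 - \<sigma>)" and "b = 1 / (1 - \<sigma> powr p)" and "c = enn_powr (ennreal a) p"
  have a_nonneg: "0 \<le> a" and b_pos: "0 < b"
    using \<sigma>_bounds \<sigma>_powr_bounds by (auto simp: a_def b_def)
  have "(\<integral>\<^sup>+ x \<in> A. enn_powr (\<Sum>k. ennreal (\<sigma> ^ k) * H k x) p \<partial>M) \<le>
      (\<integral>\<^sup>+ x. c * (\<Sum>k. enn_powr (H k x) p * indicator A x) \<partial>M)"
    unfolding c_def a_def using p_pos \<sigma>_bounds by (intro nn_integral_mono)
      (auto split: split_indicator intro!: enn_powr_geometric_suminf_le)
  also have "\<dots> = c * (\<integral>\<^sup>+ x. (\<Sum>k. enn_powr (H k x) p * indicator A x) \<partial>M)"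
    by (rule nn_integral_cmult) measurable
  also have "\<dots> = c * (\<Sum>k. enn_powr (Lp_norm p M A (H k)) p)"
    using p_pos by (subst nn_integral_suminf) (simp_all add: enn_powr_Lp_norm)
  also have "\<dots> \<le> c * (\<Sum>k. ennreal ((\<sigma> powr p) ^ k) * enn_powr X p)"
  proof (intro mult_left_mono suminf_le)
    fix k
    have "enn_powr (Lp_norm p M A (H k)) p \<le> enn_powr (ennreal (\<sigma> ^ k) * X) p"
      using p_pos Lp_norm_H_le by (intro enn_powr_mono)
    then show "enn_powr (Lp_norm p M A (H k)) p \<le> ennreal ((\<sigma> powr p) ^ k) * enn_powr X p"
      using p_pos \<sigma>_bounds by (simp add: enn_powr_mult enn_powr_ennreal power_powr_commute)
  qed auto
  also have "\<dots> = c * (ennreal b * enn_powr X p)"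
    using \<sigma>_powr_bounds
    by (simp only: ennreal_suminf_multc suminf_ennreal_geometric b_def less_imp_le)
  also have "\<dots> = enn_powr (ennreal (a * b powr (1 / p)) * X) p"
    using p_pos a_nonneg b_pos
    by (simp add: c_def ennreal_mult enn_powr_mult enn_powr_ennreal powr_powr mult.assoc)
  finally show ?thesis
    using p_pos by (simp only: Lp_norm_le_iff a_def b_def)
qed

section \<open>Layer cake and weak-type estimates\<close>

lemma borel_measurable_ennreal_mono:
  fixes F :: "real \<Rightarrow> ennreal"
  assumes "mono F"
  shows "F \<in> borel_measurable borel"
proof (rule borel_measurableI_greater)
  fix y
  have "is_interval {x. y < F x}"
    unfolding is_interval_1 using assms by (auto simp: mono_def intro: less_le_trans)
  then show "{x \<in> space borel. y < F x} \<in> sets borel"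
    by (simp add: real_interval_borel_measurable)
qed

lemma borel_measurable_ennreal_antimono:
  fixes F :: "real \<Rightarrow> ennreal"
  assumes "antimono F"
  shows "F \<in> borel_measurable borel"
proof -
  have "(\<lambda>x. F (- x)) \<in> borel_measurable borel"
    using assms by (intro borel_measurable_ennreal_mono) (auto simp: mono_def antimono_def)
  from measurable_compose[OF borel_measurable_uminus[OF measurable_ident] this] show ?thesis
    by simp
qed

lemma emeasure_lborel_below_ennreal: "emeasure lborel {l. 0 \<le> l \<and> ennreal l < x} = x"
proof (cases x)
  case (real r)
  then have "{l. 0 \<le> l \<and> ennreal l < x} = {0..<r}"
    by (auto simp: ennreal_less_iff)
  with real show ?thesis by simp
next
  case top
  have "emeasure lborel {0::real..} = top"
  proof (rule ccontr)
    assume "emeasure lborel {0::real..} \<noteq> top"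
    then obtain n where "emeasure lborel {0::real..} < of_nat n"
      using ennreal_Ex_less_of_nat by (auto simp: less_top)
    also have "of_nat n = emeasure lborel {0..real n}"
      by (simp add: ennreal_of_nat_eq_real_of_nat)
    also have "\<dots> \<le> emeasure lborel {0::real..}"
      by (intro emeasure_mono) auto
    finally show False by simp
  qed
  then show ?thesis using top by (simp add: atLeast_def)
qed

lemma (in sigma_finite_measure) nn_integral_layer_cake_sigma_finite:
  assumes [measurable]: "f \<in> borel_measurable M"
  shows "(\<integral>\<^sup>+ x. f x \<partial>M) = (\<integral>\<^sup>+ l \<in> {0..}. emeasure M {x \<in> space M. ennreal l < f x} \<partial>lborel)"
proof -
  interpret pair_sigma_finite M "lborel :: real measure" ..
  have "(\<integral>\<^sup>+ x. f x \<partial>M) = (\<integral>\<^sup>+ x. (\<integral>\<^sup>+ l. indicator {l. 0 \<le> l \<and> ennreal l < f x} l \<partial>lborel) \<partial>M)"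
    by (simp add: emeasure_lborel_below_ennreal)
  also have "\<dots> = (\<integral>\<^sup>+ l. (\<integral>\<^sup>+ x. indicator {l. 0 \<le> l \<and> ennreal l < f x} l \<partial>M) \<partial>lborel)"
    by (rule Fubini'[symmetric]) measurable
  also have "\<dots> =
      (\<integral>\<^sup>+ l. (\<integral>\<^sup>+ x. indicator {0..} l * indicator {x \<in> space M. ennreal l < f x} x \<partial>M) \<partial>lborel)"
    by (intro nn_integral_cong) (auto split: split_indicator)
  also have "\<dots> = (\<integral>\<^sup>+ l \<in> {0..}. emeasure M {x \<in> space M. ennreal l < f x} \<partial>lborel)"
    by (simp add: nn_integral_cmult_indicator mult.commute)
  finally show ?thesis .
qed

lemma sigma_finite_restrict_space_support:
  fixes f :: "'a \<Rightarrow> ennreal"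
  assumes [measurable]: "f \<in> borel_measurable M"
    and finite_levels: "\<And>l. 0 < l \<Longrightarrow> emeasure M {x \<in> space M. ennreal l < f x} < \<infinity>"
  shows "sigma_finite_measure (restrict_space M {x \<in> space M. 0 < f x})"
proof
  let ?S = "{x \<in> space M. 0 < f x}"
  let ?A = "\<lambda>n. {x \<in> space M. ennreal (1 / Suc n) < f x}"
  have level_subset: "?A n \<subseteq> ?S" for n by (auto intro: le_less_trans)
  have "\<exists>n. ennreal (1 / Suc n) < f x" if "0 < f x" for x
  proof -
    obtain y where "0 < y" "y < f x" using dense[OF \<open>0 < f x\<close>] by blast
    then obtain r where r_between: "0 < r" "ennreal r < f x" by (cases y) auto
    then obtain n where "1 / real (Suc n) < r" using nat_approx_posE by blast
    then have "ennreal (1 / real (Suc n)) < f x"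
      using r_between by (auto intro: less_trans ennreal_lessI)
    then show ?thesis ..
  qed
  then have "\<Union> (range ?A) = ?S" using level_subset by blast
  moreover have "?A n \<in> sets (restrict_space M ?S)" for n
    using level_subset by (subst sets_restrict_space_iff) auto
  moreover have "emeasure (restrict_space M ?S) (?A n) \<noteq> \<infinity>" for n
    using finite_levels[of "1 / Suc n"] level_subset by (subst emeasure_restrict_space) auto
  ultimately show "\<exists>A. countable A \<and> A \<subseteq> sets (restrict_space M ?S) \<and>
      \<Union>A = space (restrict_space M ?S) \<and>
      (\<forall>a\<in>A. emeasure (restrict_space M ?S) a \<noteq> \<infinity>)"
    by (intro exI[of _ "range ?A"]) (auto simp: space_restrict_space)
qed

lemma nn_integral_layer_cake_infinite:
  assumes [measurable]: "f \<in> borel_measurable M"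
    and infinite_level: "0 < l" "emeasure M {x \<in> space M. ennreal l < f x} = \<infinity>"
  shows "(\<integral>\<^sup>+ x. f x \<partial>M) = \<infinity>"
    and "(\<integral>\<^sup>+ l \<in> {0..}. emeasure M {x \<in> space M. ennreal l < f x} \<partial>lborel) = \<infinity>"
proof -
  have "\<infinity> = ennreal l * emeasure M {x \<in> space M. ennreal l < f x}"
    using infinite_level by (simp add: ennreal_mult_top)
  also have "\<dots> \<le> (\<integral>\<^sup>+ x. f x \<partial>M)"
    by (subst nn_integral_cmult_indicator[symmetric])
      (auto intro!: nn_integral_mono split: split_indicator)
  finally show "(\<integral>\<^sup>+ x. f x \<partial>M) = \<infinity>" by (simp add: top_unique)
  have "emeasure M {x \<in> space M. ennreal r < f x} = \<infinity>" if "r \<le> l" for r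
    using infinite_level(2) that
      emeasure_mono[of "{x \<in> space M. ennreal l < f x}" "{x \<in> space M. ennreal r < f x}" M]
    by (auto simp: top_unique intro: le_less_trans ennreal_leI)
  then have "(\<integral>\<^sup>+ r \<in> {0..l}. \<infinity> \<partial>lborel) \<le>
      (\<integral>\<^sup>+ r \<in> {0..}. emeasure M {x \<in> space M. ennreal r < f x} \<partial>lborel)"
    by (intro nn_integral_mono) (auto split: split_indicator)
  then show "(\<integral>\<^sup>+ l \<in> {0..}. emeasure M {x \<in> space M. ennreal l < f x} \<partial>lborel) = \<infinity>"
    by (subst (asm) nn_integral_cmult_indicator)
      (use infinite_level in \<open>auto simp: ennreal_top_mult top_unique\<close>)
qed

lemma nn_integral_layer_cake:
  assumes [measurable]: "f \<in> borel_measurable M"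
  shows "(\<integral>\<^sup>+ x. f x \<partial>M) = (\<integral>\<^sup>+ l \<in> {0..}. emeasure M {x \<in> space M. ennreal l < f x} \<partial>lborel)"
proof (cases "\<exists>l>0. emeasure M {x \<in> space M. ennreal l < f x} = \<infinity>")
  case True
  then show ?thesis using nn_integral_layer_cake_infinite[OF assms] by force
next
  case False
  define S where "S = {x \<in> space M. 0 < f x}"
  have [measurable]: "S \<in> sets M" unfolding S_def by measurable
  define N where "N = restrict_space M S"
  interpret N: sigma_finite_measure N
    unfolding N_def S_def using False
    by (intro sigma_finite_restrict_space_support) (auto simp: less_top)
  have emeasure_N: "emeasure N {x \<in> space N. ennreal l < f x} =
      emeasure M {x \<in> space M. ennreal l < f x}"
    if "0 \<le> l" for l
  proof -
    have "{x \<in> space N. ennreal l < f x} = {x \<in> space M. ennreal l < f x}"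
      using that by (auto simp: N_def S_def space_restrict_space intro: le_less_trans)
    then show ?thesis
      unfolding N_def by (subst emeasure_restrict_space) (auto simp: space_restrict_space)
  qed
  have "(\<integral>\<^sup>+ x. f x \<partial>M) = (\<integral>\<^sup>+ x. f x * indicator S x \<partial>M)"
    by (intro nn_integral_cong) (auto simp: S_def split: split_indicator)
  also have "\<dots> = (\<integral>\<^sup>+ x. f x \<partial>N)"
    unfolding N_def by (rule nn_integral_restrict_space[symmetric]) measurable
  also have "\<dots> = (\<integral>\<^sup>+ l \<in> {0..}. emeasure N {x \<in> space N. ennreal l < f x} \<partial>lborel)"
    unfolding N_def
    by (intro N.nn_integral_layer_cake_sigma_finite[unfolded N_def] measurable_restrict_space1)
      measurable
  also have "\<dots> = (\<integral>\<^sup>+ l \<in> {0..}. emeasure M {x \<in> space M. ennreal l < f x} \<partial>lborel)"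
    by (intro nn_integral_cong) (auto simp: emeasure_N split: split_indicator)
  finally show ?thesis .
qed

lemma nn_integral_le_of_level_sets:
  assumes [measurable]: "f \<in> borel_measurable M" "g \<in> borel_measurable N"
    and level_le: "\<And>l. 0 \<le> l \<Longrightarrow>
      emeasure M {x \<in> space M. ennreal l < f x} \<le> A * emeasure N {x \<in> space N. ennreal l < g x}"
  shows "(\<integral>\<^sup>+ x. f x \<partial>M) \<le> A * (\<integral>\<^sup>+ x. g x \<partial>N)"
proof -
  have "antimono (\<lambda>l. emeasure N {x \<in> space N. ennreal l < g x})"
    by (intro antimonoI emeasure_mono) (auto intro: le_less_trans ennreal_leI)
  then have [measurable]: "(\<lambda>l. emeasure N {x \<in> space N. ennreal l < g x}) \<in> borel_measurable borel"
    by (rule borel_measurable_ennreal_antimono)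
  have "(\<integral>\<^sup>+ x. f x \<partial>M) \<le>
      (\<integral>\<^sup>+ l. A * (emeasure N {x \<in> space N. ennreal l < g x} * indicator {0..} l) \<partial>lborel)"
    unfolding nn_integral_layer_cake[OF assms(1)] using level_le
    by (intro nn_integral_mono) (auto split: split_indicator)
  also have "\<dots> = A * (\<integral>\<^sup>+ x. g x \<partial>N)"
    unfolding nn_integral_layer_cake[OF assms(2)] by (rule nn_integral_cmult) measurable
  finally show ?thesis .
qed

definition weak_type_one_on :: "'a measure \<Rightarrow> 'a set \<Rightarrow> ('a \<Rightarrow> real) \<Rightarrow> bool" where
  "weak_type_one_on M A h \<longleftrightarrow> (\<forall>l>0. emeasure M {x \<in> space M. x \<in> A \<and> l < h x} \<le> ennreal (1 / l))"

lemma emeasure_powr_level_set_le: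
  assumes "weak_type_one_on M A h" and h_nonneg: "\<And>x. x \<in> A \<Longrightarrow> 0 \<le> h x"
    and [measurable]: "A \<in> sets M" "h \<in> borel_measurable M" and "0 < \<beta>" "0 < l"
  shows "emeasure M {x \<in> space M. ennreal l < ennreal (h x powr \<beta>) * indicator A x} \<le>
      ennreal (l powr - (1 / \<beta>))"
proof -
  have "l powr (1 / \<beta>) < h x" if "x \<in> A" "l < h x powr \<beta>" for x
  proof -
    have "l powr (1 / \<beta>) < (h x powr \<beta>) powr (1 / \<beta>)"
      using that \<open>0 < \<beta>\<close> \<open>0 < l\<close> by (intro powr_less_mono2) auto
    then show ?thesis
      using h_nonneg[OF that(1)] \<open>0 < \<beta>\<close> by (simp add: powr_powr)
  qed
  then have "emeasure M {x \<in> space M. ennreal l < ennreal (h x powr \<beta>) * indicator A x} \<le>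
      emeasure M {x \<in> space M. x \<in> A \<and> l powr (1 / \<beta>) < h x}"
    using \<open>0 < l\<close> by (intro emeasure_mono) (auto simp: ennreal_less_iff split: split_indicator_asm)
  also have "\<dots> \<le> ennreal (1 / l powr (1 / \<beta>))"
    using assms(1) \<open>0 < l\<close> by (simp add: weak_type_one_on_def)
  finally show ?thesis
    by (simp add: powr_minus_divide)
qed

lemma nn_integral_powr_le_of_weak_type_bounded:
  assumes weak_type: "weak_type_one_on M A h" and h_bounds: "\<And>x. x \<in> A \<Longrightarrow> 0 \<le> h x \<and> h x \<le> R"
    and [measurable]: "A \<in> sets M" "h \<in> borel_measurable M" and one_less_\<beta>: "1 < \<beta>"
      and R_pos: "0 < R"
  shows "(\<integral>\<^sup>+ x \<in> A. ennreal (h x powr \<beta>) \<partial>M) \<le> ennreal (\<beta> / (\<beta> - 1) * R powr (\<beta> - 1))"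
proof -
  let ?f = "\<lambda>x. ennreal (h x powr \<beta>) * indicator A x"
  define \<mu> where "\<mu> l = emeasure M {x \<in> space M. ennreal l < ?f x}" for l
  have \<mu>_above: "\<mu> l = 0" if "R powr \<beta> < l" for l
  proof -
    have "h x powr \<beta> \<le> l" if "x \<in> A" for x
      using h_bounds[OF that] one_less_\<beta> \<open>R powr \<beta> < l\<close> powr_mono2[of \<beta> "h x" R] by simp
    then have "{x \<in> space M. ennreal l < ?f x} = {}"
      by (auto simp: not_less split: split_indicator intro: ennreal_leI)
    then show ?thesis by (simp only: \<mu>_def emeasure_empty)
  qed
  have "(\<integral>\<^sup>+ x. ?f x \<partial>M) = (\<integral>\<^sup>+ l \<in> {0..}. \<mu> l \<partial>lborel)"
    unfolding \<mu>_def by (rule nn_integral_layer_cake) measurable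
  also have "\<dots> \<le> (\<integral>\<^sup>+ l. ennreal (l powr - (1 / \<beta>)) * indicator {0..R powr \<beta>} l \<partial>lborel)"
  proof (rule nn_integral_mono_AE)
    show "AE l in lborel. \<mu> l * indicator {0..} l
        \<le> ennreal (l powr - (1 / \<beta>)) * indicator {0..R powr \<beta>} l"
      using AE_lborel_singleton[of 0]
    proof eventually_elim
      case (elim l)
      then show ?case
        using emeasure_powr_level_set_le[OF weak_type _ assms(3,4), of \<beta> l] h_bounds one_less_\<beta>
          \<mu>_above[of l]
        unfolding \<mu>_def[symmetric] by (auto split: split_indicator)
    qed
  qed
  also have "\<dots> = ennreal ((R powr \<beta>) powr (- (1 / \<beta>) + 1) / (- (1 / \<beta>) + 1))"
    using one_less_\<beta> by (intro nn_integral_has_integral_lebesgue' has_integral_powr_from_0) auto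
  also have "(R powr \<beta>) powr (- (1 / \<beta>) + 1) / (- (1 / \<beta>) + 1) = \<beta> / (\<beta> - 1) * R powr (\<beta> - 1)"
  proof -
    have "- (1 / \<beta>) + 1 = (\<beta> - 1) / \<beta>"
      using one_less_\<beta> by (simp add: field_simps)
    then show ?thesis using one_less_\<beta> by (simp add: powr_powr)
  qed
  finally show ?thesis .
qed

lemma Kolmogorov_weak_type_inequality:
  assumes weak_type: "weak_type_one_on M A h" and h_nonneg: "\<And>x. x \<in> A \<Longrightarrow> 0 \<le> h x"
    and [measurable]: "A \<in> sets M" "h \<in> borel_measurable M" and \<alpha>_bounds: "0 < \<alpha>" "\<alpha> < 1"
    and emeasure_A_le_m: "emeasure M A \<le> ennreal m" "0 < m"
  shows "(\<integral>\<^sup>+ x \<in> A. ennreal (h x powr \<alpha>) \<partial>M) \<le> ennreal (1 / (1 - \<alpha>) * m powr (1 - \<alpha>))"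
proof -
  let ?f = "\<lambda>x. ennreal (h x powr \<alpha>) * indicator A x"
  define T where "T = m powr - \<alpha>"
  have T_pos: "0 < T" using emeasure_A_le_m by (simp add: T_def)
  define \<mu> where "\<mu> l = emeasure M {x \<in> space M. ennreal l < ?f x}" for l
  have \<mu>_le_m: "\<mu> l \<le> ennreal m" if "0 \<le> l" for l
  proof -
    have "\<mu> l \<le> emeasure M A"
      unfolding \<mu>_def by (intro emeasure_mono) (auto split: split_indicator_asm)
    then show ?thesis using emeasure_A_le_m by simp
  qed
  have "(\<integral>\<^sup>+ x. ?f x \<partial>M) = (\<integral>\<^sup>+ l \<in> {0..}. \<mu> l \<partial>lborel)"
    unfolding \<mu>_def by (rule nn_integral_layer_cake) measurable
  also have "\<dots> \<le>
      (\<integral>\<^sup>+ l. ennreal m * indicator {0..T} l + ennreal (l powr - (1 / \<alpha>)) * indicator {T..} l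
        \<partial>lborel)"
  proof (rule nn_integral_mono)
    fix l
    show "\<mu> l * indicator {0..} l \<le>
        ennreal m * indicator {0..T} l + ennreal (l powr - (1 / \<alpha>)) * indicator {T..} l"
      using \<mu>_le_m[of l]
        emeasure_powr_level_set_le[OF weak_type h_nonneg assms(3,4) \<alpha>_bounds(1), of l] T_pos
      unfolding \<mu>_def[symmetric] by (auto split: split_indicator intro: add_increasing2)
  qed
  also have "\<dots> = ennreal m * ennreal T + ennreal (- (T powr (- (1 / \<alpha>) + 1)) / (- (1 / \<alpha>) + 1))"
    using \<alpha>_bounds T_pos
    by (subst nn_integral_add, measurable,
      subst nn_integral_has_integral_lebesgue'[OF _ has_integral_powr_to_inf])
      (auto simp: nn_integral_cmult_indicator field_simps)
  also have "\<dots> = ennreal (1 / (1 - \<alpha>) * m powr (1 - \<alpha>))"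
  proof -
    have "m * T = m powr (1 - \<alpha>)"
      using emeasure_A_le_m by (simp add: T_def powr_diff powr_minus field_simps)
    moreover have "T powr (- (1 / \<alpha>) + 1) = m powr (1 - \<alpha>)"
      using \<alpha>_bounds by (simp add: T_def powr_powr algebra_simps)
    ultimately show ?thesis
      using \<alpha>_bounds emeasure_A_le_m T_pos
      by (simp add: ennreal_mult[symmetric] ennreal_plus[symmetric] field_simps del: ennreal_plus)
  qed
  finally show ?thesis .
qed

section \<open>Tails of diffuse measures on the line\<close>

locale diffuse_borel_measure =
  fixes \<nu> :: "real measure"
  assumes sets_eq_borel [measurable_cong]: "sets \<nu> = sets borel"
    and emeasure_singleton: "emeasure \<nu> {a} = 0"
begin

lemma space_eq_UNIV [simp]: "space \<nu> = UNIV"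
  using sets_eq_imp_space_eq[OF sets_eq_borel] by simp

lemma tail_mono: "a \<le> b \<Longrightarrow> emeasure \<nu> {b<..} \<le> emeasure \<nu> {a<..}"
  by (intro emeasure_mono) auto

lemma borel_measurable_tail [measurable]: "(\<lambda>a. emeasure \<nu> {a<..}) \<in> borel_measurable borel"
  by (intro borel_measurable_ennreal_antimono antimonoI tail_mono)

lemma emeasure_atLeast: "emeasure \<nu> {a..} = emeasure \<nu> {a<..}"
proof -
  have "emeasure \<nu> ({a} \<union> {a<..}) = emeasure \<nu> {a} + emeasure \<nu> {a<..}"
    by (intro plus_emeasure[symmetric]) auto
  moreover have "{a} \<union> {a<..} = {a..}" by auto
  ultimately show ?thesis by (simp add: emeasure_singleton)
qed

lemma tail_le_of_right:
  assumes right_tail_le: "\<And>b. a < b \<Longrightarrow> emeasure \<nu> {b<..} \<le> x"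
  shows "emeasure \<nu> {a<..} \<le> x"
proof -
  let ?B = "\<lambda>n. {a + 1 / real (Suc n)<..}"
  have "s \<in> (\<Union>n. ?B n)" if "a < s" for s
  proof -
    obtain n where "1 / real (Suc n) < s - a"
      using nat_approx_posE[of "s - a"] \<open>a < s\<close> by auto
    then show ?thesis by (auto intro!: exI[of _ n])
  qed
  moreover have "a < s" if "s \<in> ?B n" for s n
  proof -
    have "0 \<le> 1 / real (Suc n)" by simp
    with that show ?thesis unfolding greaterThan_iff by linarith
  qed
  ultimately have "{a<..} = (\<Union>n. ?B n)" by blast
  also have "emeasure \<nu> (\<Union>n. ?B n) = (SUP n. emeasure \<nu> (?B n))"
    by (intro SUP_emeasure_incseq[symmetric])
      (auto simp: incseq_def frac_le intro!: order.strict_trans1[OF add_left_mono])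
  also have "\<dots> \<le> x"
    by (intro SUP_least right_tail_le) simp
  finally show ?thesis .
qed

lemma emeasure_up_set:
  assumes up_closed: "\<And>s s'. s \<in> U \<Longrightarrow> s \<le> s' \<Longrightarrow> s' \<in> U"
    and U_nonempty_bdd_below: "U \<noteq> {}" "bdd_below U"
  shows "emeasure \<nu> U = emeasure \<nu> {Inf U<..}"
proof (rule antisym)
  have "is_interval U"
    unfolding is_interval_1 using up_closed by blast
  then have [measurable]: "U \<in> sets borel"
    by (rule real_interval_borel_measurable)
  have "emeasure \<nu> U \<le> emeasure \<nu> {Inf U..}"
    using U_nonempty_bdd_below by (intro emeasure_mono) (auto intro: cInf_lower)
  then show "emeasure \<nu> U \<le> emeasure \<nu> {Inf U<..}"
    by (simp add: emeasure_atLeast)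
  have "{Inf U<..} \<subseteq> U"
    using U_nonempty_bdd_below
    by (meson cInf_less_iff greaterThan_iff less_imp_le subsetI up_closed)
  then show "emeasure \<nu> {Inf U<..} \<le> emeasure \<nu> U"
    by (intro emeasure_mono) measurable
qed

lemma emeasure_tail_sublevel_le: "emeasure \<nu> {s. m \<le> s \<and> emeasure \<nu> {s<..} \<le> x} \<le> x"
proof (cases "{s. m \<le> s \<and> emeasure \<nu> {s<..} \<le> x} = {}")
  case True
  then show ?thesis by (simp only: emeasure_empty zero_le)
next
  case False
  let ?U = "{s. m \<le> s \<and> emeasure \<nu> {s<..} \<le> x}"
  have U_bdd_below: "bdd_below ?U" by (auto intro: bdd_belowI[of _ m])
  have "emeasure \<nu> ?U = emeasure \<nu> {Inf ?U<..}"
  proof (rule emeasure_up_set[OF _ False U_bdd_below])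
    fix s s' assume "s \<in> ?U" "s \<le> s'"
    then show "s' \<in> ?U" using tail_mono[of s s'] by (auto intro: order_trans)
  qed
  also have "\<dots> \<le> x"
  proof (rule tail_le_of_right)
    fix b assume "Inf ?U < b"
    then obtain u where "u \<in> ?U" "u < b"
      using cInf_less_iff[OF False U_bdd_below] by blast
    then show "emeasure \<nu> {b<..} \<le> x"
      using tail_mono[of u b] by (auto intro: order_trans)
  qed
  finally show ?thesis .
qed

lemma weak_type_one_on_inverse_tail:
  assumes A_bdd_below: "bdd_below A" and finite_tails: "\<And>s. s \<in> A \<Longrightarrow> emeasure \<nu> {s<..} < \<infinity>"
  shows "weak_type_one_on \<nu> A (\<lambda>s. 1 / enn2real (emeasure \<nu> {s<..}))"
  unfolding weak_type_one_on_def
proof safe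
  fix l :: real assume l_pos: "0 < l"
  obtain m where m_le: "\<And>s. s \<in> A \<Longrightarrow> m \<le> s" using A_bdd_below by (auto simp: bdd_below_def)
  have "emeasure \<nu> {s<..} \<le> ennreal (1 / l)"
    if s_in_level_set: "s \<in> A" "l < 1 / enn2real (emeasure \<nu> {s<..})" for s
  proof -
    have "enn2real (emeasure \<nu> {s<..}) \<le> 1 / l"
      using s_in_level_set(2) l_pos
      by (cases "enn2real (emeasure \<nu> {s<..}) = 0") (auto simp: field_simps enn2real_nonneg less_le)
    then have "ennreal (enn2real (emeasure \<nu> {s<..})) \<le> ennreal (1 / l)" by (rule ennreal_leI)
    then show ?thesis using finite_tails[OF s_in_level_set(1)] by simp
  qed
  then have "emeasure \<nu> {s \<in> space \<nu>. s \<in> A \<and> l < 1 / enn2real (emeasure \<nu> {s<..})} \<le>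
      emeasure \<nu> {s. m \<le> s \<and> emeasure \<nu> {s<..} \<le> ennreal (1 / l)}"
    using m_le by (intro emeasure_mono) auto
  also have "\<dots> \<le> ennreal (1 / l)" by (rule emeasure_tail_sublevel_le)
  finally show "emeasure \<nu> {s \<in> space \<nu>. s \<in> A \<and> l < 1 / enn2real (emeasure \<nu> {s<..})} \<le>
      ennreal (1 / l)" .
qed

lemma Lp_norm_tail_powr_before:
  assumes p_pos: "0 < p" and \<epsilon>_pos: "0 < \<epsilon>" and t_pos: "0 < t"
    and tail_eq: "\<And>s. 0 < s \<Longrightarrow> 0 < b s \<and> emeasure \<nu> {s<..} = ennreal (b s powr p)"
  shows "Lp_norm p \<nu> {0<..<t} (\<lambda>s. ennreal (b s powr - (1 + \<epsilon>))) \<le>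
    ennreal (((1 + \<epsilon>) / \<epsilon>) powr (1 / p) * b t powr - \<epsilon>)"
proof -
  let ?h = "\<lambda>s. 1 / enn2real (emeasure \<nu> {s<..})"
  have inverse_tail_eq: "?h s = b s powr - p" if "0 < s" for s
    using tail_eq[OF that] by (simp add: powr_minus_divide)
  have inverse_tail_mono: "b s powr - p \<le> b t powr - p" if "s \<in> {0<..<t}" for s
  proof -
    have "b t powr p \<le> b s powr p"
      using tail_mono[of s t] tail_eq[of s] tail_eq[of t] that t_pos by (simp add: ennreal_le_iff)
    then show ?thesis
      using tail_eq[of t] tail_eq[of s] t_pos that by (simp add: powr_minus_divide frac_le)
  qed
  have "(\<integral>\<^sup>+ s \<in> {0<..<t}. enn_powr (ennreal (b s powr - (1 + \<epsilon>))) p \<partial>\<nu>) =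
      (\<integral>\<^sup>+ s \<in> {0<..<t}. ennreal (?h s powr (1 + \<epsilon>)) \<partial>\<nu>)"
    by (intro nn_integral_cong)
      (auto split: split_indicator simp: inverse_tail_eq enn_powr_ennreal powr_powr algebra_simps)
  also have "\<dots> \<le> ennreal ((1 + \<epsilon>) / (1 + \<epsilon> - 1) * (b t powr - p) powr (1 + \<epsilon> - 1))"
  proof (rule nn_integral_powr_le_of_weak_type_bounded)
    show "weak_type_one_on \<nu> {0<..<t} ?h"
      using tail_eq by (intro weak_type_one_on_inverse_tail) auto
    show "0 \<le> ?h s \<and> ?h s \<le> b t powr - p" if "s \<in> {0<..<t}" for s
      using inverse_tail_mono[OF that] inverse_tail_eq[of s] that by auto
    show "0 < b t powr - p"
      using tail_eq[OF t_pos] by simp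
  qed (use \<epsilon>_pos in auto)
  also have "\<dots> = enn_powr (ennreal (((1 + \<epsilon>) / \<epsilon>) powr (1 / p) * b t powr - \<epsilon>)) p"
    using p_pos \<epsilon>_pos by (simp add: enn_powr_ennreal powr_mult powr_powr mult.commute)
  finally show ?thesis
    using p_pos by (simp add: Lp_norm_le_iff)
qed

lemma Lp_norm_tail_powr_after:
  assumes p_pos: "0 < p" and \<delta>_bounds: "0 < \<delta>" "\<delta> < 1" and t_pos: "0 < t"
    and tail_eq: "\<And>s. 0 < s \<Longrightarrow> 0 < b s \<and> emeasure \<nu> {s<..} = ennreal (b s powr p)"
  shows "Lp_norm p \<nu> {t<..} (\<lambda>s. ennreal (b s powr - \<delta>)) \<le>
    ennreal ((1 / (1 - \<delta>)) powr (1 / p) * b t powr (1 - \<delta>))"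
proof -
  let ?h = "\<lambda>s. 1 / enn2real (emeasure \<nu> {s<..})"
  have inverse_tail_eq: "?h s = b s powr - p" if "0 < s" for s
    using tail_eq[OF that] by (simp add: powr_minus_divide)
  have "(\<integral>\<^sup>+ s \<in> {t<..}. enn_powr (ennreal (b s powr - \<delta>)) p \<partial>\<nu>) =
      (\<integral>\<^sup>+ s \<in> {t<..}. ennreal (?h s powr \<delta>) \<partial>\<nu>)"
    using t_pos by (intro nn_integral_cong)
      (auto split: split_indicator simp: inverse_tail_eq enn_powr_ennreal powr_powr algebra_simps)
  also have "\<dots> \<le> ennreal (1 / (1 - \<delta>) * (b t powr p) powr (1 - \<delta>))"
  proof (rule Kolmogorov_weak_type_inequality)
    show "weak_type_one_on \<nu> {t<..} ?h"
      using tail_eq t_pos by (intro weak_type_one_on_inverse_tail) auto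
    show "emeasure \<nu> {t<..} \<le> ennreal (b t powr p)" "0 < b t powr p"
      using tail_eq[OF t_pos] by auto
  qed (use \<delta>_bounds in \<open>auto simp: enn2real_nonneg\<close>)
  also have "\<dots> = enn_powr (ennreal ((1 / (1 - \<delta>)) powr (1 / p) * b t powr (1 - \<delta>))) p"
    using p_pos \<delta>_bounds by (simp add: enn_powr_ennreal powr_mult powr_powr mult.commute)
  finally show ?thesis
    using p_pos by (simp add: Lp_norm_le_iff)
qed

lemma tail_dilation_at_0:
  assumes c_pos: "0 < c"
    and tail_dilation_le: "\<And>a. 0 < a \<Longrightarrow> emeasure \<nu> {a / c<..} \<le> A * emeasure \<nu> {a<..}"
  shows "emeasure \<nu> {0<..} \<le> A * emeasure \<nu> {0<..}"
proof (rule tail_le_of_right)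
  fix b :: real assume "0 < b"
  then have "emeasure \<nu> {b<..} \<le> A * emeasure \<nu> {c * b<..}"
    using tail_dilation_le[of "c * b"] c_pos by simp
  also have "\<dots> \<le> A * emeasure \<nu> {0<..}"
    using \<open>0 < b\<close> c_pos by (intro mult_left_mono tail_mono) auto
  finally show "emeasure \<nu> {b<..} \<le> A * emeasure \<nu> {0<..}" .
qed

lemma nn_integral_mono_dilation_le:
  fixes F :: "real \<Rightarrow> ennreal"
  assumes mono_F: "mono F" and c_pos: "0 < c"
    and tail_dilation_le: "\<And>a. 0 < a \<Longrightarrow> emeasure \<nu> {a / c<..} \<le> A * emeasure \<nu> {a<..}"
  shows "(\<integral>\<^sup>+ s \<in> {0<..}. F (c * s) \<partial>\<nu>) \<le> A * (\<integral>\<^sup>+ s \<in> {0<..}. F s \<partial>\<nu>)"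
proof (rule nn_integral_le_of_level_sets)
  have [measurable]: "F \<in> borel_measurable borel" by (rule borel_measurable_ennreal_mono[OF mono_F])
  show "(\<lambda>s. F (c * s) * indicator {0<..} s) \<in> borel_measurable \<nu>"
    "(\<lambda>s. F s * indicator {0<..} s) \<in> borel_measurable \<nu>"
    by measurable
  fix l :: real assume "0 \<le> l"
  define U where "U = {s. 0 < s \<and> ennreal l < F s}"
  have level_sets_eq: "{s \<in> space \<nu>. ennreal l < F s * indicator {0<..} s} = U"
    "{s \<in> space \<nu>. ennreal l < F (c * s) * indicator {0<..} s} = {s. c * s \<in> U}"
    using c_pos by (auto simp: U_def zero_less_mult_iff split: split_indicator_asm)
  have "emeasure \<nu> {s. c * s \<in> U} \<le> A * emeasure \<nu> U"
  proof (cases "U = {}")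
    case False
    have U_bdd_below: "bdd_below U" by (auto simp: U_def intro!: bdd_belowI[of _ 0])
    have Inf_U_nonneg: "0 \<le> Inf U" using False by (intro cInf_greatest) (auto simp: U_def)
    have "{s. c * s \<in> U} \<subseteq> {Inf U / c..}"
      using U_bdd_below c_pos by (auto simp: divide_le_eq mult.commute intro: cInf_lower)
    then have "emeasure \<nu> {s. c * s \<in> U} \<le> emeasure \<nu> {Inf U / c..}"
      by (intro emeasure_mono) auto
    also have "\<dots> \<le> A * emeasure \<nu> {Inf U<..}"
      using tail_dilation_le[of "Inf U"] tail_dilation_at_0[OF c_pos tail_dilation_le] Inf_U_nonneg
      by (cases "Inf U = 0") (auto simp: emeasure_atLeast)
    also have "emeasure \<nu> {Inf U<..} = emeasure \<nu> U"
      using False U_bdd_below by (intro emeasure_up_set[symmetric])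
        (auto simp: U_def intro: less_le_trans monoD[OF mono_F])
    finally show ?thesis .
  qed simp
  then show "emeasure \<nu> {s \<in> space \<nu>. ennreal l < F (c * s) * indicator {0<..} s} \<le>
      A * emeasure \<nu> {s \<in> space \<nu>. ennreal l < F s * indicator {0<..} s}"
    by (simp only: level_sets_eq)
qed

lemma Lp_norm_mono_dilation_le:
  assumes "mono F" "0 < p" "0 < c"
    and "\<And>a. 0 < a \<Longrightarrow> emeasure \<nu> {a / c<..} \<le> enn_powr A p * emeasure \<nu> {a<..}"
  shows "Lp_norm p \<nu> {0<..} (\<lambda>s. F (c * s)) \<le> A * Lp_norm p \<nu> {0<..} F"
proof -
  have "mono (\<lambda>s. enn_powr (F s) p)"
    using assms by (auto simp: mono_def intro: enn_powr_mono)
  from nn_integral_mono_dilation_le[OF this assms(3,4)] show ?thesis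
    using \<open>0 < p\<close> by (simp add: Lp_norm_le_iff enn_powr_mult enn_powr_Lp_norm)
qed

lemma mono_mult_tail_le_Lp_norm:
  assumes "mono F" and p_pos: "0 < p"
  shows "F t * enn_powr (emeasure \<nu> {t<..}) (1 / p) \<le> Lp_norm p \<nu> {t<..} F"
proof -
  have "F t * enn_powr (emeasure \<nu> {t<..}) (1 / p) = Lp_norm p \<nu> {t<..} (\<lambda>_. F t)"
    using p_pos by (simp add: Lp_norm_const)
  also have "\<dots> \<le> Lp_norm p \<nu> {t<..} F"
    using assms by (intro Lp_norm_mono) (auto intro: monoD)
  finally show ?thesis .
qed

end

section \<open>A Hardy inequality\<close>

lemma suminf_remainder_contraction:
  fixes u :: "nat \<Rightarrow> ennreal" and L :: real
  assumes L_pos: "0 < L" and remainder: "(\<Sum>j. u (Suc j)) \<le> ennreal L * u 0"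
  shows "(\<Sum>j. u (Suc j)) \<le> ennreal (L / (1 + L)) * (\<Sum>j. u j)"
proof -
  define R where "R = (\<Sum>j. u (Suc j))"
  have split_head: "(\<Sum>j. u j) = R + u 0"
    using suminf_offset[of u 1] by (simp add: R_def)
  have "ennreal (1 + L) * R = R + ennreal L * R"
    using L_pos by (simp add: distrib_right)
  also have "\<dots> \<le> ennreal L * u 0 + ennreal L * R"
    unfolding R_def by (intro add_right_mono remainder)
  also have "\<dots> = ennreal L * (\<Sum>j. u j)"
    by (simp add: split_head distrib_left add.commute)
  also have "\<dots> = ennreal (1 + L) * (ennreal (L / (1 + L)) * (\<Sum>j. u j))"
    using L_pos by (simp add: ennreal_mult_mult del: ennreal_plus)
  finally show ?thesis
    unfolding R_def using L_pos by (subst (asm) ennreal_mult_le_mult_iff) auto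
qed

lemma geometric_decay_of_remainder_bound:
  fixes u :: "nat \<Rightarrow> ennreal" and L :: real
  assumes L_pos: "0 < L" and remainder: "\<And>k. (\<Sum>j. u (Suc j + k)) \<le> ennreal L * u k"
  defines "\<rho> \<equiv> L / (1 + L)"
  shows "u k \<le> ennreal ((1 + L) * \<rho> ^ k) * u 0"
proof (cases k)
  case 0
  have "ennreal 1 * u 0 \<le> ennreal (1 + L) * u 0"
    using L_pos by (intro mult_right_mono ennreal_leI) auto
  with 0 show ?thesis by simp
next
  case (Suc m)
  have \<rho>_eq: "0 \<le> \<rho>" "(1 + L) * \<rho> = L" using L_pos by (auto simp: \<rho>_def)
  have "(\<Sum>j. u (Suc j + n)) \<le> ennreal (L * \<rho> ^ n) * u 0" for n
  proof (induction n)
    case 0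
    then show ?case using remainder[of 0] by simp
  next
    case (Suc n)
    have "(\<Sum>j. u (Suc j + Suc n)) \<le> ennreal \<rho> * (\<Sum>j. u (Suc j + n))"
      using suminf_remainder_contraction[of L "\<lambda>j. u (j + Suc n)"] L_pos remainder[of "Suc n"]
      by (simp add: \<rho>_def)
    also have "\<dots> \<le> ennreal \<rho> * (ennreal (L * \<rho> ^ n) * u 0)"
      by (intro mult_left_mono Suc) simp
    also have "\<dots> = ennreal (L * \<rho> ^ Suc n) * u 0"
      using L_pos \<rho>_eq(1) by (subst ennreal_mult_mult) (auto simp: mult_ac)
    finally show ?case .
  qed
  from this[of m] have "u k \<le> ennreal (L * \<rho> ^ m) * u 0"
    using term_le_suminf_ennreal[of "\<lambda>j. u (Suc j + m)" 0] by (simp add: Suc)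
  also have "L * \<rho> ^ m = (1 + L) * \<rho> ^ k"
    by (simp add: Suc \<rho>_eq(2) flip: mult.assoc)
  finally show ?thesis .
qed

lemma sum_dyadic_powr_le:
  fixes s t p :: real
  assumes p_pos: "0 < p" and s_pos: "0 < s"
  shows "0 < t \<Longrightarrow> (\<Sum>j<n. if t / 2 ^ j < s then (t / 2 ^ j) powr p else 0) \<le>
    1 / (1 - 2 powr - p) * min s t powr p"
proof (induction n arbitrary: t)
  case 0
  have "2 powr - p < 1" using p_pos by (simp add: powr_less_one)
  then show ?case by simp
next
  case (Suc n)
  define q where "q = 2 powr - p"
  have half_powr: "0 < 1 - q" "(t / 2) powr p = q * t powr p"
    using p_pos Suc.prems by (auto simp: q_def powr_less_one powr_divide powr_minus_divide)
  have "(\<Sum>j<Suc n. if t / 2 ^ j < s then (t / 2 ^ j) powr p else 0) =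
      (if t < s then t powr p else 0) +
        (\<Sum>j<n. if t / 2 / 2 ^ j < s then (t / 2 / 2 ^ j) powr p else 0)"
  proof -
    have "t / 2 ^ Suc j = t / 2 / 2 ^ j" for j by simp
    then show ?thesis by (subst sum.lessThan_Suc_shift) (simp only: power_0 div_by_1)
  qed
  also have "\<dots> \<le> (if t < s then t powr p else 0) + 1 / (1 - q) * min s (t / 2) powr p"
    unfolding q_def using Suc.prems by (intro add_left_mono Suc.IH) simp
  also have "\<dots> \<le> 1 / (1 - q) * min s t powr p"
  proof (cases "t < s")
    case True
    have "t powr p + 1 / (1 - q) * (q * t powr p) = 1 / (1 - q) * t powr p"
      using half_powr(1) by (simp add: field_simps)
    then show ?thesis using True Suc.prems half_powr(2) by (simp add: min_absorb2)
  next
    case False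
    then have "min s (t / 2) powr p \<le> min s t powr p"
      using p_pos s_pos Suc.prems by (intro powr_mono2) auto
    then show ?thesis using False half_powr by (simp add: divide_right_mono)
  qed
  finally show ?case unfolding q_def .
qed

lemma dyadic_telescope_le:
  fixes G H :: "real \<Rightarrow> ennreal"
  assumes H_doubling: "\<And>s. 0 < s \<Longrightarrow> ennreal s * H s \<le> ennreal s * H (2 * s) + G (2 * s)"
    and H_tendsto_0: "(H \<longlongrightarrow> 0) at_top" and s_pos: "0 < s"
  shows "ennreal s * H s \<le> (\<Sum>k. ennreal ((1 / 2) ^ k) * G (2 ^ Suc k * s))"
proof -
  let ?a = "\<lambda>k. ennreal ((1 / 2) ^ k) * G (2 ^ Suc k * s)"
  have partial_sum_bound: "ennreal s * H s \<le> ennreal s * H (2 ^ n * s) + (\<Sum>k<n. ?a k)" for n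
  proof (induction n)
    case (Suc n)
    have "ennreal s * H (2 ^ n * s) = ennreal ((1 / 2) ^ n) * (ennreal (2 ^ n * s) * H (2 ^ n * s))"
      using s_pos by (simp add: mult.assoc[symmetric] ennreal_mult[symmetric] power_one_over)
    also have "\<dots> \<le>
        ennreal ((1 / 2) ^ n) * (ennreal (2 ^ n * s) * H (2 * (2 ^ n * s)) + G (2 * (2 ^ n * s)))"
      using s_pos by (intro mult_left_mono H_doubling) auto
    also have "\<dots> = ennreal s * H (2 ^ Suc n * s) + ?a n"
      using s_pos
      by (simp add: distrib_left mult.assoc[symmetric] ennreal_mult[symmetric] power_one_over)
    finally show ?case
      using Suc by (auto simp: add_ac intro: order_trans add_right_mono add_left_mono)
  qed simp
  have "filterlim (\<lambda>n. 2 ^ n * s) at_top sequentially"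
    using s_pos by (intro filterlim_at_top_mult_tendsto_pos[where c = s])
      (auto intro!: filterlim_at_infinity_imp_filterlim_at_top filterlim_realpow_sequentially_gt1)
  then have "(\<lambda>n. H (2 ^ n * s)) \<longlonglongrightarrow> 0"
    by (rule filterlim_compose[OF H_tendsto_0])
  then have "(\<lambda>n. ennreal s * H (2 ^ n * s) + (\<Sum>k<n. ?a k)) \<longlonglongrightarrow> ennreal s * 0 + (\<Sum>k. ?a k)"
    by (intro tendsto_add ennreal_tendsto_cmult summable_LIMSEQ) auto
  then show ?thesis
    using partial_sum_bound
    by (intro LIMSEQ_le_const[where X = "\<lambda>n. ennreal s * H (2 ^ n * s) + (\<Sum>k<n. ?a k)"]) auto
qed

definition RB_measure :: "real \<Rightarrow> real measure \<Rightarrow> bool" where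
  "RB_measure p \<nu> \<longleftrightarrow> (\<exists>C::real. 0 < C \<and> (\<forall>t>0.
     (\<integral>\<^sup>+ s \<in> {0<..<t}. ennreal (s powr p) \<partial>\<nu>) \<le>
       ennreal C * (ennreal (t powr p) * emeasure \<nu> {t<..})))"

context diffuse_borel_measure
begin

lemma suminf_dyadic_tails_le:
  assumes p_pos: "0 < p" and t_pos: "0 < t"
  shows "(\<Sum>j. ennreal ((t / 2 ^ j) powr p) * emeasure \<nu> {t / 2 ^ j<..}) \<le>
    ennreal (1 / (1 - 2 powr - p)) * (\<integral>\<^sup>+ s \<in> {0<..}. ennreal (min s t powr p) \<partial>\<nu>)"
proof -
  define D where "D = 1 / (1 - 2 powr - p)"
  have D_pos: "0 < D" using p_pos by (simp add: D_def powr_less_one)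
  have "(\<Sum>j. ennreal ((t / 2 ^ j) powr p) * emeasure \<nu> {t / 2 ^ j<..}) =
      (\<Sum>j. \<integral>\<^sup>+ s. ennreal ((t / 2 ^ j) powr p) * indicator {t / 2 ^ j<..} s \<partial>\<nu>)"
    by (simp add: nn_integral_cmult_indicator)
  also have "\<dots> = (\<integral>\<^sup>+ s. (\<Sum>j. ennreal ((t / 2 ^ j) powr p) * indicator {t / 2 ^ j<..} s) \<partial>\<nu>)"
    by (rule nn_integral_suminf[symmetric]) measurable
  also have "\<dots> \<le> (\<integral>\<^sup>+ s. ennreal D * (ennreal (min s t powr p) * indicator {0<..} s) \<partial>\<nu>)"
  proof (intro nn_integral_mono suminf_le_const summableI)
    fix s n
    have "0 < t / 2 ^ j" for j :: nat using t_pos by simp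
    then have no_terms_below_0: "\<not> t / 2 ^ j < s" if "s \<le> 0" for j :: nat
      using that by (meson le_less_trans less_asym)
    have "(\<Sum>j<n. ennreal ((t / 2 ^ j) powr p) * indicator {t / 2 ^ j<..} s) =
        (\<Sum>j<n. ennreal (if t / 2 ^ j < s then (t / 2 ^ j) powr p else 0))"
      by (intro sum.cong) (auto split: split_indicator)
    also have "\<dots> = ennreal (\<Sum>j<n. if t / 2 ^ j < s then (t / 2 ^ j) powr p else 0)"
      by (rule sum_ennreal) simp
    also have "\<dots> \<le> ennreal D * (ennreal (min s t powr p) * indicator {0<..} s)"
      using sum_dyadic_powr_le[OF p_pos _ t_pos, of s n] no_terms_below_0 D_pos
      by (cases "0 < s") (auto simp: D_def ennreal_mult[symmetric] intro: ennreal_leI)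
    finally show "(\<Sum>j<n. ennreal ((t / 2 ^ j) powr p) * indicator {t / 2 ^ j<..} s) \<le>
        ennreal D * (ennreal (min s t powr p) * indicator {0<..} s)" .
  qed
  also have "\<dots> = ennreal D * (\<integral>\<^sup>+ s \<in> {0<..}. ennreal (min s t powr p) \<partial>\<nu>)"
    by (rule nn_integral_cmult) measurable
  finally show ?thesis unfolding D_def .
qed

lemma RB_measure_imp_dyadic_remainder_bound:
  assumes p_pos: "0 < p" and RB: "RB_measure p \<nu>"
  obtains L :: real where "0 < L"
    "\<And>t. 0 < t \<Longrightarrow> (\<Sum>j. ennreal ((t / 2 ^ Suc j) powr p) * emeasure \<nu> {t / 2 ^ Suc j<..}) \<le>
      ennreal L * (ennreal (t powr p) * emeasure \<nu> {t<..})"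
proof -
  obtain C :: real where C_pos: "0 < C"
    and mass_before_le: "\<And>t. 0 < t \<Longrightarrow> (\<integral>\<^sup>+ s \<in> {0<..<t}. ennreal (s powr p) \<partial>\<nu>)
      \<le> ennreal C * (ennreal (t powr p) * emeasure \<nu> {t<..})"
    using RB unfolding RB_measure_def by blast
  define D where "D = 1 / (1 - 2 powr - p)"
  have D_pos: "0 < D" using p_pos by (simp add: D_def powr_less_one)
  show ?thesis
  proof (rule that)
    show "0 < D * (1 + C)" using C_pos D_pos by simp
    fix t :: real assume t_pos: "0 < t"
    let ?u = "ennreal (t powr p) * emeasure \<nu> {t<..}"
    have "(\<Sum>j. ennreal ((t / 2 ^ Suc j) powr p) * emeasure \<nu> {t / 2 ^ Suc j<..}) \<le>
        ennreal D * (\<integral>\<^sup>+ s \<in> {0<..}. ennreal (min s (t / 2) powr p) \<partial>\<nu>)"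
      using suminf_dyadic_tails_le[OF p_pos, of "t / 2"] t_pos
      by (simp add: D_def divide_divide_eq_left)
    also have "\<dots> \<le> ennreal D * (\<integral>\<^sup>+ s. ennreal (s powr p) * indicator {0<..<t} s
        + ennreal (t powr p) * indicator {t..} s \<partial>\<nu>)"
      using p_pos t_pos by (intro mult_left_mono nn_integral_mono)
        (auto split: split_indicator intro!: ennreal_leI powr_mono2)
    also have "\<dots> = ennreal D * ((\<integral>\<^sup>+ s \<in> {0<..<t}. ennreal (s powr p) \<partial>\<nu>) + ?u)"
      by (subst nn_integral_add) (auto simp: nn_integral_cmult_indicator emeasure_atLeast)
    also have "\<dots> \<le> ennreal D * (ennreal C * ?u + ?u)"
      by (intro mult_left_mono add_right_mono mass_before_le t_pos) simp
    also have "\<dots> = ennreal (D * (1 + C)) * ?u"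
      using C_pos D_pos by (simp add: ennreal_mult distrib_left distrib_right mult_ac add_ac)
    finally show "(\<Sum>j. ennreal ((t / 2 ^ Suc j) powr p) * emeasure \<nu> {t / 2 ^ Suc j<..}) \<le>
      ennreal (D * (1 + C)) * ?u" .
  qed
qed

lemma RB_measure_imp_tail_decay:
  assumes p_pos: "0 < p" and RB: "RB_measure p \<nu>"
  obtains A \<sigma> :: real where "0 < A" "0 < \<sigma>" "\<sigma> < 1"
    "\<And>t k. 0 < t \<Longrightarrow> emeasure \<nu> {t / 2 ^ k<..} \<le>
      enn_powr (ennreal (A * (2 * \<sigma>\<^sup>2) ^ k)) p * emeasure \<nu> {t<..}"
proof -
  obtain L :: real where L_pos: "0 < L" and remainder: "\<And>t. 0 < t \<Longrightarrow>
      (\<Sum>j. ennreal ((t / 2 ^ Suc j) powr p) * emeasure \<nu> {t / 2 ^ Suc j<..}) \<le>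
      ennreal L * (ennreal (t powr p) * emeasure \<nu> {t<..})"
    using RB_measure_imp_dyadic_remainder_bound[OF p_pos RB] by blast
  define \<rho> where "\<rho> = L / (1 + L)"
  have \<rho>_bounds: "0 < \<rho>" "\<rho> < 1" using L_pos by (auto simp: \<rho>_def)
  define A where "A = (1 + L) powr (1 / p)"
  define \<sigma> where "\<sigma> = \<rho> powr (1 / (2 * p))"
  have A_powr: "0 < A" "A powr p = 1 + L" using p_pos L_pos by (auto simp: A_def powr_powr)
  have \<sigma>_bounds: "0 < \<sigma>" "\<sigma> < 1" using p_pos \<rho>_bounds by (auto simp: \<sigma>_def powr01_less_one)
  have \<sigma>_powr: "(\<sigma> powr p)\<^sup>2 = \<rho>"
    using p_pos \<rho>_bounds by (simp add: \<sigma>_def powr_powr power2_eq_square powr_add[symmetric])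
  show ?thesis
  proof (rule that[OF A_powr(1) \<sigma>_bounds])
    fix t :: real and k assume t_pos: "0 < t"
    define u where "u k = ennreal ((t / 2 ^ k) powr p) * emeasure \<nu> {t / 2 ^ k<..}" for k
    have "u k \<le> ennreal ((1 + L) * \<rho> ^ k) * u 0"
      unfolding \<rho>_def
    proof (rule geometric_decay_of_remainder_bound[OF L_pos])
      fix k
      show "(\<Sum>j. u (Suc j + k)) \<le> ennreal L * u k"
        using remainder[of "t / 2 ^ k"] t_pos by (simp add: u_def power_add mult_ac)
    qed
    also have "\<dots> = ennreal ((t / 2 ^ k) powr p) *
        (ennreal ((1 + L) * \<rho> ^ k * (2 ^ k) powr p) * emeasure \<nu> {t<..})"
      unfolding u_def power_0 div_by_1 using L_pos \<rho>_bounds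
      by (intro ennreal_mult_mult_cong) (auto simp: powr_divide)
    finally have "emeasure \<nu> {t / 2 ^ k<..} \<le>
        ennreal ((1 + L) * \<rho> ^ k * (2 ^ k) powr p) * emeasure \<nu> {t<..}"
      unfolding u_def using t_pos by (subst (asm) ennreal_mult_le_mult_iff) auto
    also have "(1 + L) * \<rho> ^ k * (2 ^ k) powr p = (A * (2 * \<sigma>\<^sup>2) ^ k) powr p"
      by (simp add: powr_mult power_mult_distrib power_powr_commute A_powr \<sigma>_powr)
    finally show "emeasure \<nu> {t / 2 ^ k<..} \<le>
        enn_powr (ennreal (A * (2 * \<sigma>\<^sup>2) ^ k)) p * emeasure \<nu> {t<..}"
      using A_powr \<sigma>_bounds by (simp add: enn_powr_ennreal)
  qed
qed

lemma Lp_norm_dyadic_dilation_le: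
  assumes p_pos: "0 < p" and A_pos: "0 < A" and \<sigma>_pos: "0 < \<sigma>" and mono_G: "mono G"
    and decay: "\<And>t k. 0 < t \<Longrightarrow> emeasure \<nu> {t / 2 ^ k<..} \<le>
      enn_powr (ennreal (A * (2 * \<sigma>\<^sup>2) ^ k)) p * emeasure \<nu> {t<..}"
  shows "Lp_norm p \<nu> {0<..} (\<lambda>s. ennreal ((1 / (2 * \<sigma>)) ^ k) * G (2 ^ Suc k * s)) \<le>
    ennreal (\<sigma> ^ k) * (ennreal (A * (2 * \<sigma>\<^sup>2)) * Lp_norm p \<nu> {0<..} G)"
proof -
  have [measurable]: "G \<in> borel_measurable borel" by (rule borel_measurable_ennreal_mono[OF mono_G])
  have "(1 / (2 * \<sigma>)) ^ k * (A * (2 * \<sigma>\<^sup>2) ^ Suc k) =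
      (1 / (2 * \<sigma>)) ^ k * (2 * \<sigma>\<^sup>2) ^ k * (A * (2 * \<sigma>\<^sup>2))"
    by (simp only: power_Suc mult_ac)
  also have "(1 / (2 * \<sigma>)) ^ k * (2 * \<sigma>\<^sup>2) ^ k = \<sigma> ^ k"
    unfolding power_mult_distrib[symmetric] using \<sigma>_pos by (simp add: power2_eq_square)
  finally have factor: "(1 / (2 * \<sigma>)) ^ k * (A * (2 * \<sigma>\<^sup>2) ^ Suc k) = \<sigma> ^ k * (A * (2 * \<sigma>\<^sup>2))" .
  have "Lp_norm p \<nu> {0<..} (\<lambda>s. ennreal ((1 / (2 * \<sigma>)) ^ k) * G (2 ^ Suc k * s)) =
      ennreal ((1 / (2 * \<sigma>)) ^ k) * Lp_norm p \<nu> {0<..} (\<lambda>s. G (2 ^ Suc k * s))"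
    using p_pos by (intro Lp_norm_cmult) auto
  also have "\<dots> \<le>
      ennreal ((1 / (2 * \<sigma>)) ^ k) * (ennreal (A * (2 * \<sigma>\<^sup>2) ^ Suc k) * Lp_norm p \<nu> {0<..} G)"
    using p_pos by (intro mult_left_mono Lp_norm_mono_dilation_le mono_G decay) auto
  also have "\<dots> = ennreal (\<sigma> ^ k) * (ennreal (A * (2 * \<sigma>\<^sup>2)) * Lp_norm p \<nu> {0<..} G)"
    using A_pos \<sigma>_pos factor by (intro ennreal_mult_mult_cong) auto
  finally show ?thesis .
qed

lemma RB_measure_imp_hardy_dyadic:
  assumes p_pos: "0 < p" and RB: "RB_measure p \<nu>"
  obtains B :: ennreal where "B < \<infinity>"
    "\<And>G H. mono G \<Longrightarrow> (\<And>s. 0 < s \<Longrightarrow> ennreal s * H s \<le> ennreal s * H (2 * s) + G (2 * s)) \<Longrightarrow>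
      (H \<longlongrightarrow> 0) at_top \<Longrightarrow> Lp_norm p \<nu> {0<..} (\<lambda>s. ennreal s * H s) \<le> B * Lp_norm p \<nu> {0<..} G"
proof -
  obtain A \<sigma> :: real where A_pos: "0 < A" and \<sigma>_bounds: "0 < \<sigma>" "\<sigma> < 1"
    and decay: "\<And>t k. 0 < t \<Longrightarrow> emeasure \<nu> {t / 2 ^ k<..} \<le>
      enn_powr (ennreal (A * (2 * \<sigma>\<^sup>2) ^ k)) p * emeasure \<nu> {t<..}"
    using RB_measure_imp_tail_decay[OF p_pos RB] by blast
  define E where "E = 1 / (1 - \<sigma>) * (1 / (1 - \<sigma> powr p)) powr (1 / p)"
  show ?thesis
  proof (rule that)
    show "ennreal E * ennreal (A * (2 * \<sigma>\<^sup>2)) < \<infinity>" by (simp add: ennreal_mult_less_top)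
    fix G H :: "real \<Rightarrow> ennreal"
    assume mono_G: "mono G"
      and H_doubling: "\<And>s. 0 < s \<Longrightarrow> ennreal s * H s \<le> ennreal s * H (2 * s) + G (2 * s)"
      and H_tendsto_0: "(H \<longlongrightarrow> 0) at_top"
    have [measurable]: "G \<in> borel_measurable borel"
      by (rule borel_measurable_ennreal_mono[OF mono_G])
    have half_power: "ennreal ((1 / 2) ^ k) * x =
        ennreal (\<sigma> ^ k) * (ennreal ((1 / (2 * \<sigma>)) ^ k) * x)" for k x
      using \<sigma>_bounds by (simp add: ennreal_mult_mult flip: power_mult_distrib)
    have "Lp_norm p \<nu> {0<..} (\<lambda>s. ennreal s * H s) \<le> Lp_norm p \<nu> {0<..}
        (\<lambda>s. \<Sum>k. ennreal (\<sigma> ^ k) * (ennreal ((1 / (2 * \<sigma>)) ^ k) * G (2 ^ Suc k * s)))"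
      using dyadic_telescope_le[OF H_doubling H_tendsto_0] unfolding half_power
      by (intro Lp_norm_mono p_pos) auto
    also have "\<dots> \<le> ennreal E * (ennreal (A * (2 * \<sigma>\<^sup>2)) * Lp_norm p \<nu> {0<..} G)"
      unfolding E_def using Lp_norm_dyadic_dilation_le[OF p_pos A_pos \<sigma>_bounds(1) mono_G decay]
      by (intro Lp_norm_geometric_suminf_le p_pos \<sigma>_bounds) auto
    finally show "Lp_norm p \<nu> {0<..} (\<lambda>s. ennreal s * H s) \<le>
        ennreal E * ennreal (A * (2 * \<sigma>\<^sup>2)) * Lp_norm p \<nu> {0<..} G"
      by (simp only: mult.assoc)
  qed
qed

end

section \<open>The measure attached to a weight\<close>

text \<open>Pushed forward to the Borel sets, so that only Borel functions need be integrated.\<close>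

definition weight_measure :: "real \<Rightarrow> (real \<Rightarrow> ennreal) \<Rightarrow> real measure" where
  "weight_measure p w =
    distr (density lebesgue (\<lambda>s. ennreal (s powr - p) * w s * indicator {0<..} s)) borel (\<lambda>s. s)"

lemma sets_weight_measure [measurable_cong, simp]: "sets (weight_measure p w) = sets borel"
  by (simp add: weight_measure_def)

lemma borel_measurable_weight_density:
  assumes "weight w"
  shows "(\<lambda>s. ennreal (s powr - p) * w s * indicator {0<..} s) \<in> borel_measurable lebesgue"
proof -
  have "(\<lambda>s::real. ennreal (s powr - p)) \<in> borel_measurable lebesgue"
    by (rule measurable_completion) measurable
  moreover have "(\<lambda>s. w s * indicator {0<..} s) \<in> borel_measurable lebesgue"
    using assms unfolding weight_def
    by (subst (asm) borel_measurable_restrict_space_iff_ennreal) auto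
  ultimately show ?thesis
    unfolding mult.assoc by measurable
qed

lemma nn_integral_weight_measure:
  assumes weight_w: "weight w" and [measurable]: "F \<in> borel_measurable borel" "A \<in> sets borel"
    and A_subset: "A \<subseteq> {0<..}"
  shows "(\<integral>\<^sup>+ s \<in> A. F s \<partial>weight_measure p w) =
      (\<integral>\<^sup>+ s \<in> A. F s * (ennreal (s powr - p) * w s) \<partial>lebesgue)"
proof -
  let ?v = "\<lambda>s. ennreal (s powr - p) * w s * indicator {0<..} s"
  have "(\<lambda>s. s) \<in> measurable lebesgue borel" "(\<lambda>s. F s * indicator A s) \<in> borel_measurable lebesgue"
    by (rule measurable_completion, measurable)+
  then have "(\<integral>\<^sup>+ s \<in> A. F s \<partial>weight_measure p w) = (\<integral>\<^sup>+ s \<in> A. F s \<partial>density lebesgue ?v)"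
    unfolding weight_measure_def by (intro nn_integral_distr) simp_all
  also have "\<dots> = (\<integral>\<^sup>+ s. ?v s * (F s * indicator A s) \<partial>lebesgue)"
    by (intro nn_integral_density borel_measurable_weight_density weight_w) fact
  also have "\<dots> = (\<integral>\<^sup>+ s \<in> A. F s * (ennreal (s powr - p) * w s) \<partial>lebesgue)"
    using A_subset by (intro nn_integral_cong) (auto simp: mult_ac split: split_indicator)
  finally show ?thesis .
qed

lemma emeasure_weight_measure:
  assumes "weight w" "A \<in> sets borel" "A \<subseteq> {0<..}"
  shows "emeasure (weight_measure p w) A = (\<integral>\<^sup>+ s \<in> A. ennreal (s powr - p) * w s \<partial>lebesgue)"
proof -
  have "emeasure (weight_measure p w) A = (\<integral>\<^sup>+ s \<in> A. 1 \<partial>weight_measure p w)"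
    using assms by simp
  also have "\<dots> = (\<integral>\<^sup>+ s \<in> A. ennreal (s powr - p) * w s \<partial>lebesgue)"
    using assms by (subst nn_integral_weight_measure) auto
  finally show ?thesis .
qed

lemma diffuse_weight_measure:
  assumes "weight w"
  shows "diffuse_borel_measure (weight_measure p w)"
proof
  fix a :: real
  have "{a} \<in> null_sets lebesgue"
    by (rule null_sets_completionI) (simp add: null_sets_def)
  moreover have "(\<lambda>s. s) \<in> measurable lebesgue (borel :: real measure)"
    by (rule measurable_completion) measurable
  ultimately show "emeasure (weight_measure p w) {a} = 0"
    unfolding weight_measure_def
    by (simp add: emeasure_distr emeasure_density borel_measurable_weight_density assms
      nn_integral_null_set)
qed simp

lemma psi_eq:
  assumes "weight w" "0 < t"
  shows "psi p w t = enn_powr (emeasure (weight_measure p w) {t<..}) (1 / p)"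
  using assms unfolding psi_def by (subst emeasure_weight_measure) auto

lemma RB_imp_RB_measure:
  assumes weight_w: "weight w" and RB: "RB p w"
  shows "RB_measure p (weight_measure p w)"
proof -
  have mass_before_eq: "(\<integral>\<^sup>+ s \<in> {0<..<t}. ennreal (s powr p) \<partial>weight_measure p w) =
      (\<integral>\<^sup>+ s \<in> {0<..<t}. w s \<partial>lebesgue)" for t
  proof -
    have "ennreal (s powr p) * (ennreal (s powr - p) * w s) = w s" if "0 < s" for s
      using that by (simp add: mult.assoc[symmetric] ennreal_mult[symmetric] powr_add[symmetric])
    then show ?thesis
      using weight_w
      by (subst nn_integral_weight_measure) (auto intro!: nn_integral_cong split: split_indicator)
  qed
  have tail_eq: "emeasure (weight_measure p w) {t<..} =
      (\<integral>\<^sup>+ s \<in> {t<..}. w s / ennreal (s powr p) \<partial>lebesgue)"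
    if "0 < t" for t
    using weight_w that by (subst emeasure_weight_measure)
      (auto intro!: nn_integral_cong split: split_indicator
        simp: divide_ennreal_def inverse_ennreal powr_minus mult.commute)
  show ?thesis
    using RB unfolding RB_def RB_measure_def by (auto simp: mass_before_eq tail_eq mult.assoc)
qed

section \<open>Rearrangements\<close>

lemma ennreal_eqI_of_le_iff:
  fixes x y :: ennreal
  assumes "\<And>l. 0 \<le> l \<Longrightarrow> x \<le> ennreal l \<longleftrightarrow> y \<le> ennreal l"
  shows "x = y"
proof (rule antisym)
  show "x \<le> y" using assms by (cases y) auto
  show "y \<le> x" using assms by (cases x) auto
qed

lemma rearrangement_mono: "s \<le> t \<Longrightarrow> rearrangement M f t \<le> rearrangement M f s"
  unfolding rearrangement_def
  by (intro Inf_superset_mono) (blast intro: order_trans ennreal_leI)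

lemma borel_measurable_rearrangement [measurable]: "rearrangement M f \<in> borel_measurable borel"
  by (intro borel_measurable_ennreal_antimono antimonoI rearrangement_mono)

lemma rearrangement_le:
  "0 \<le> l \<Longrightarrow> emeasure M {x \<in> space M. l < \<bar>f x\<bar>} \<le> ennreal t \<Longrightarrow> rearrangement M f t \<le> ennreal l"
  unfolding rearrangement_def by (rule Inf_lower) auto

lemma rearrangement_le_iff:
  assumes [measurable]: "f \<in> borel_measurable M" and l_nonneg: "0 \<le> l"
  shows "rearrangement M f t \<le> ennreal l \<longleftrightarrow> emeasure M {x \<in> space M. l < \<bar>f x\<bar>} \<le> ennreal t"
proof
  assume rearrangement_le_l: "rearrangement M f t \<le> ennreal l"
  let ?A = "\<lambda>n. {x \<in> space M. l + 1 / real (Suc n) < \<bar>f x\<bar>}"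
  have emeasure_level_le: "emeasure M (?A n) \<le> ennreal t" for n
  proof -
    have "rearrangement M f t < ennreal (l + 1 / real (Suc n))"
      using l_nonneg
      by (intro le_less_trans[OF rearrangement_le_l] ennreal_lessI) (auto simp: add_nonneg_pos)
    then obtain l' where l'_level: "0 \<le> l'" "l' < l + 1 / real (Suc n)"
      "emeasure M {x \<in> space M. l' < \<bar>f x\<bar>} \<le> ennreal t"
      using l_nonneg unfolding rearrangement_def Inf_less_iff
      by (auto simp: ennreal_less_iff simp del: ennreal_plus)
    then have "emeasure M (?A n) \<le> emeasure M {x \<in> space M. l' < \<bar>f x\<bar>}"
      by (intro emeasure_mono) auto
    with l'_level show ?thesis by simp
  qed
  have "incseq ?A"
    by (intro incseq_SucI) (auto simp: frac_le intro: order.strict_trans1[rotated])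
  moreover have "{x \<in> space M. l < \<bar>f x\<bar>} = (\<Union>n. ?A n)"
  proof safe
    fix x assume "x \<in> space M" "l < \<bar>f x\<bar>"
    then show "x \<in> (\<Union>n. ?A n)"
      using nat_approx_posE[of "\<bar>f x\<bar> - l"] by (auto simp: algebra_simps)
  next
    fix x n assume "l + 1 / real (Suc n) < \<bar>f x\<bar>"
    moreover have "0 \<le> 1 / real (Suc n)" by simp
    ultimately show "l < \<bar>f x\<bar>" by linarith
  qed
  ultimately have "emeasure M {x \<in> space M. l < \<bar>f x\<bar>} = (SUP n. emeasure M (?A n))"
    by (simp only:) (intro SUP_emeasure_incseq[symmetric], auto)
  then show "emeasure M {x \<in> space M. l < \<bar>f x\<bar>} \<le> ennreal t"
    using emeasure_level_le by (auto intro: SUP_least)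
qed (use l_nonneg in \<open>rule rearrangement_le\<close>)

lemma rearrangement_add_le:
  assumes [measurable]: "f0 \<in> borel_measurable M" "f1 \<in> borel_measurable M"
    and decomposition: "decomposes M f f0 f1" and st_nonneg: "0 \<le> s" "0 \<le> t"
  shows "rearrangement M f (s + t) \<le> rearrangement M f0 s + rearrangement M f1 t"
proof (cases "rearrangement M f0 s"; cases "rearrangement M f1 t")
  fix r0 r1
  assume rearrangement_f0_eq: "0 \<le> r0" "rearrangement M f0 s = ennreal r0"
    and rearrangement_f1_eq: "0 \<le> r1" "rearrangement M f1 t = ennreal r1"
  have "emeasure M {x \<in> space M. r0 + r1 < \<bar>f x\<bar>} \<le>
      emeasure M ({x \<in> space M. r0 < \<bar>f0 x\<bar>} \<union> {x \<in> space M. r1 < \<bar>f1 x\<bar>})"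
    using decomposition by (intro emeasure_mono) (auto simp: decomposes_def)
  also have "\<dots> \<le> emeasure M {x \<in> space M. r0 < \<bar>f0 x\<bar>} + emeasure M {x \<in> space M. r1 < \<bar>f1 x\<bar>}"
    by (intro emeasure_subadditive) auto
  also have "\<dots> \<le> ennreal s + ennreal t"
    using rearrangement_f0_eq rearrangement_f1_eq
    by (intro add_mono) (auto simp flip: rearrangement_le_iff)
  finally have "rearrangement M f (s + t) \<le> ennreal (r0 + r1)"
    using rearrangement_f0_eq rearrangement_f1_eq st_nonneg by (intro rearrangement_le) auto
  then show ?thesis using rearrangement_f0_eq rearrangement_f1_eq by simp
qed auto

lemma rearrangement_uminus: "rearrangement M (\<lambda>x. - f x) = rearrangement M f"
  by (simp add: rearrangement_def fun_eq_iff)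

lemma rearrangement_diff_truncation:
  assumes [measurable]: "f \<in> borel_measurable M" "f0 \<in> borel_measurable M" and c_nonneg: "0 \<le> c"
    and abs_f0: "\<And>x. x \<in> space M \<Longrightarrow> \<bar>f0 x\<bar> = max 0 (\<bar>f x\<bar> - c)"
  shows "rearrangement M f0 s = rearrangement M f s - ennreal c"
proof (rule ennreal_eqI_of_le_iff)
  fix l :: real assume l_nonneg: "0 \<le> l"
  have "{x \<in> space M. l < \<bar>f0 x\<bar>} = {x \<in> space M. l + c < \<bar>f x\<bar>}"
    using l_nonneg abs_f0 by auto
  then have "rearrangement M f0 s \<le> ennreal l \<longleftrightarrow> rearrangement M f s \<le> ennreal (l + c)"
    using l_nonneg c_nonneg by (simp add: rearrangement_le_iff del: ennreal_plus)
  then show "rearrangement M f0 s \<le> ennreal l \<longleftrightarrow> rearrangement M f s - ennreal c \<le> ennreal l"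
    using l_nonneg c_nonneg by (simp add: ennreal_minus_le_iff add.commute)
qed

lemma rearrangement_truncation:
  assumes [measurable]: "f \<in> borel_measurable M" "f1 \<in> borel_measurable M" and c_nonneg: "0 \<le> c"
    and abs_f1: "\<And>x. x \<in> space M \<Longrightarrow> \<bar>f1 x\<bar> = min c \<bar>f x\<bar>"
  shows "rearrangement M f1 s = min (ennreal c) (rearrangement M f s)"
proof (rule ennreal_eqI_of_le_iff)
  fix l :: real assume l_nonneg: "0 \<le> l"
  have "{x \<in> space M. l < \<bar>f1 x\<bar>} = (if l < c then {x \<in> space M. l < \<bar>f x\<bar>} else {})"
    using abs_f1 by auto
  then show "rearrangement M f1 s \<le> ennreal l \<longleftrightarrow> min (ennreal c) (rearrangement M f s) \<le> ennreal l"
    using l_nonneg c_nonneg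
    by (auto simp: rearrangement_le_iff min_le_iff_disj ennreal_le_iff not_less)
qed

definition vanishing :: "'a measure \<Rightarrow> ('a \<Rightarrow> real) set" where
  "vanishing M = {f \<in> borel_measurable M. (rearrangement M f \<longlongrightarrow> 0) at_top}"

lemma vanishing_measurable [measurable_dest]: "f \<in> vanishing M \<Longrightarrow> f \<in> borel_measurable M"
  by (simp add: vanishing_def)

lemma vanishing_tendsto: "f \<in> vanishing M \<Longrightarrow> (rearrangement M f \<longlongrightarrow> 0) at_top"
  by (simp add: vanishing_def)

lemma rearrangement_less_top:
  assumes f_vanishing: "f \<in> vanishing M" and t_pos: "0 < t"
  shows "rearrangement M f t < \<infinity>"
proof -
  note [measurable] = vanishing_measurable[OF f_vanishing]
  have "eventually (\<lambda>T. rearrangement M f T < 1) at_top"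
    using vanishing_tendsto[OF f_vanishing] by (rule order_tendstoD) simp
  then obtain T where "rearrangement M f T < 1"
    using eventually_happens by fastforce
  then have emeasure_level_le: "emeasure M {x \<in> space M. 1 < \<bar>f x\<bar>} \<le> ennreal T"
    using rearrangement_le_iff[of f M 1 T] by (simp add: less_imp_le)
  define A where "A n = {x \<in> space M. 1 + real n < \<bar>f x\<bar>}" for n :: nat
  have finite_levels: "emeasure M (A n) \<noteq> \<infinity>" for n
  proof -
    have "emeasure M (A n) \<le> emeasure M {x \<in> space M. 1 < \<bar>f x\<bar>}"
      unfolding A_def by (intro emeasure_mono) auto
    with emeasure_level_le show ?thesis by (auto simp: top_unique)
  qed
  have "\<exists>n. x \<notin> A n" for x
  proof -
    obtain n :: nat where "\<bar>f x\<bar> \<le> real n" using real_arch_simple by blast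
    then have "x \<notin> A n" by (simp add: A_def)
    then show ?thesis ..
  qed
  then have Inter_A_empty: "(\<Inter>n. A n) = {}" by blast
  have "(\<lambda>n. emeasure M (A n)) \<longlonglongrightarrow> emeasure M (\<Inter>n. A n)"
    using finite_levels by (intro Lim_emeasure_decseq) (auto simp: A_def decseq_def)
  then have "eventually (\<lambda>n. emeasure M (A n) < ennreal t) sequentially"
    unfolding Inter_A_empty by (rule order_tendstoD) (use t_pos in simp)
  then obtain n where "emeasure M (A n) < ennreal t"
    using eventually_happens by fastforce
  then have "rearrangement M f t \<le> ennreal (1 + real n)"
    unfolding A_def by (intro rearrangement_le) auto
  then show ?thesis using le_less_trans by fastforce
qed

lemma vanishing_add:
  assumes f0_vanishing: "f0 \<in> vanishing M" and f1_vanishing: "f1 \<in> vanishing M"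
    and decomposition: "decomposes M f f0 f1"
  shows "f \<in> vanishing M"
proof -
  note [measurable] = vanishing_measurable[OF f0_vanishing] vanishing_measurable[OF f1_vanishing]
  have "f \<in> borel_measurable M"
    using decomposition
    by (subst measurable_cong[where g = "\<lambda>x. f0 x + f1 x"]) (auto simp: decomposes_def)
  moreover have "(rearrangement M f \<longlongrightarrow> 0) at_top"
  proof (rule tendsto_sandwich[OF _ _ tendsto_const])
    have half_at_top: "filterlim (\<lambda>t::real. t / 2) at_top at_top"
      by (rule filterlim_at_top_mult_tendsto_pos[where f = "\<lambda>_. 1 / 2" and c = "1 / 2", simplified])
        (auto simp: filterlim_ident)
    show "((\<lambda>t. rearrangement M f0 (t / 2) + rearrangement M f1 (t / 2)) \<longlongrightarrow> 0) at_top"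
      using tendsto_add[OF filterlim_compose[OF vanishing_tendsto[OF f0_vanishing] half_at_top]
          filterlim_compose[OF vanishing_tendsto[OF f1_vanishing] half_at_top]] by simp
    show "eventually (\<lambda>t. rearrangement M f t \<le>
        rearrangement M f0 (t / 2) + rearrangement M f1 (t / 2)) at_top"
      using eventually_gt_at_top[of 0]
    proof eventually_elim
      case (elim t)
      then show ?case using rearrangement_add_le[OF _ _ decomposition, of "t / 2" "t / 2"] by simp
    qed
  qed simp
  ultimately show ?thesis by (simp add: vanishing_def)
qed

lemma vanishing_of_rearrangement_le:
  assumes "f \<in> vanishing M" "g \<in> borel_measurable M" "\<And>s. rearrangement M g s \<le> rearrangement M f s"
  shows "g \<in> vanishing M"
  using assms tendsto_sandwich[OF _ _ tendsto_const[of 0],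
    where g = "rearrangement M g" and h = "rearrangement M f"]
  by (auto simp: vanishing_def)

section \<open>The mass of a rearrangement above its value\<close>

definition rearrangement_mass :: "'a measure \<Rightarrow> ('a \<Rightarrow> real) \<Rightarrow> real \<Rightarrow> ennreal" where
  "rearrangement_mass M f t = (\<integral>\<^sup>+ s \<in> {0<..<t}. rearrangement M f s \<partial>lborel)"

definition osc_mass :: "'a measure \<Rightarrow> ('a \<Rightarrow> real) \<Rightarrow> real \<Rightarrow> ennreal" where
  "osc_mass M f t = (\<integral>\<^sup>+ s \<in> {0<..<t}. (rearrangement M f s - rearrangement M f t) \<partial>lborel)"

lemma nn_integral_lborel_const_Ioo:
  "0 \<le> t \<Longrightarrow> (\<integral>\<^sup>+ s \<in> {0<..<t}. c \<partial>lborel) = ennreal t * c" for t :: real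
  by (simp add: nn_integral_cmult_indicator mult.commute)

lemma mono_rearrangement_mass: "mono (rearrangement_mass M f)"
  unfolding rearrangement_mass_def
  by (intro monoI nn_integral_mono) (auto split: split_indicator)

lemma mono_osc_mass: "mono (osc_mass M f)"
  unfolding osc_mass_def
  by (intro monoI nn_integral_mono)
    (auto split: split_indicator intro: ennreal_minus_mono rearrangement_mono)

lemma borel_measurable_rearrangement_mass [measurable]:
  "rearrangement_mass M f \<in> borel_measurable borel"
  by (intro borel_measurable_ennreal_mono mono_rearrangement_mass)

lemma borel_measurable_osc_mass [measurable]: "osc_mass M f \<in> borel_measurable borel"
  by (intro borel_measurable_ennreal_mono mono_osc_mass)

lemma osc_eq:
  assumes t_pos: "0 < t" and finite_rearrangement: "rearrangement M f t < \<infinity>"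
  shows "osc M f t = osc_mass M f t / ennreal t"
proof -
  define c where "c = enn2real (rearrangement M f t)"
  have rearrangement_eq_c: "rearrangement M f t = ennreal c" "0 \<le> c"
    using finite_rearrangement by (auto simp: c_def)
  have "osc_mass M f t = (\<integral>\<^sup>+ s. rearrangement M f s * indicator {0<..<t} s
      - ennreal c * indicator {0<..<t} s \<partial>lborel)"
    unfolding osc_mass_def rearrangement_eq_c
    by (intro nn_integral_cong) (auto split: split_indicator)
  also have "\<dots> = rearrangement_mass M f t - ennreal t * ennreal c"
    unfolding rearrangement_mass_def
      nn_integral_lborel_const_Ioo[OF less_imp_le[OF t_pos], symmetric]
  proof (rule nn_integral_diff)
    show "AE s in lborel. ennreal c * indicator {0<..<t} s \<le>
        rearrangement M f s * indicator {0<..<t} s"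
      unfolding rearrangement_eq_c(1)[symmetric]
      by (auto intro!: rearrangement_mono split: split_indicator)
    show "(\<integral>\<^sup>+ s \<in> {0<..<t}. ennreal c \<partial>lborel) \<noteq> \<infinity>"
      using t_pos by (subst nn_integral_lborel_const_Ioo) (auto simp: ennreal_mult_eq_top_iff)
  qed measurable
  finally have "osc_mass M f t = rearrangement_mass M f t - ennreal (t * c)"
    using t_pos rearrangement_eq_c by (simp add: ennreal_mult)
  moreover have "(\<integral>\<^sup>+ s \<in> {0<..<t}. rearrangement M f s \<partial>lebesgue) = rearrangement_mass M f t"
    unfolding rearrangement_mass_def by (rule nn_integral_completion)
  ultimately show ?thesis
    unfolding osc_def max_rearrangement_def rearrangement_eq_c(1)
    using t_pos rearrangement_eq_c by (cases "rearrangement_mass M f t")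
      (auto simp: ennreal_minus_if divide_ennreal ennreal_top_divide field_simps)
qed

lemma rearrangement_doubling_le:
  assumes s_pos: "0 < s"
  shows "ennreal s * rearrangement M f s \<le>
      ennreal s * rearrangement M f (2 * s) + osc_mass M f (2 * s)"
proof -
  let ?d = "rearrangement M f s - rearrangement M f (2 * s)"
  have "ennreal s * ?d = (\<integral>\<^sup>+ r \<in> {0<..<s}. ?d \<partial>lborel)"
    using s_pos by (simp add: nn_integral_lborel_const_Ioo)
  also have "\<dots> \<le> osc_mass M f (2 * s)"
    unfolding osc_mass_def
    by (intro nn_integral_mono)
      (auto split: split_indicator intro!: ennreal_minus_mono rearrangement_mono)
  finally have jump_le: "ennreal s * ?d \<le> osc_mass M f (2 * s)" .
  have "rearrangement M f s = rearrangement M f (2 * s) + ?d"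
    using s_pos by (intro ennreal_ineq_diff_add rearrangement_mono) auto
  then have "ennreal s * rearrangement M f s =
      ennreal s * rearrangement M f (2 * s) + ennreal s * ?d"
    by (metis distrib_left)
  with jump_le show ?thesis by (simp add: add_left_mono)
qed

lemma rearrangement_mass_le:
  assumes "0 < t"
  shows "rearrangement_mass M f t \<le> osc_mass M f t + ennreal t * rearrangement M f t"
proof -
  have "rearrangement_mass M f t \<le>
      (\<integral>\<^sup>+ s. (rearrangement M f s - rearrangement M f t) * indicator {0<..<t} s
      + rearrangement M f t * indicator {0<..<t} s \<partial>lborel)"
    unfolding rearrangement_mass_def
    by (intro nn_integral_mono) (auto split: split_indicator simp: diff_add_self_ennreal)
  also have "\<dots> = osc_mass M f t + ennreal t * rearrangement M f t"
    using assms unfolding osc_mass_def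
    by (subst nn_integral_add) (auto simp: nn_integral_lborel_const_Ioo)
  finally show ?thesis .
qed

lemma rearrangement_le_mass: "0 < t \<Longrightarrow> ennreal t * rearrangement M f t \<le> rearrangement_mass M f t"
  unfolding rearrangement_mass_def
  by (subst nn_integral_lborel_const_Ioo[symmetric])
    (auto intro!: nn_integral_mono rearrangement_mono split: split_indicator)

lemma nn_integral_half_dilation:
  fixes h :: "real \<Rightarrow> ennreal"
  assumes [measurable]: "h \<in> borel_measurable borel"
  shows "(\<integral>\<^sup>+ r \<in> {0<..<t}. h (r / 2) \<partial>lborel) = 2 * (\<integral>\<^sup>+ r \<in> {0<..<t / 2}. h r \<partial>lborel)"
proof -
  have "(\<integral>\<^sup>+ r \<in> {0<..<t}. h (r / 2) \<partial>lborel) =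
      ennreal \<bar>2\<bar> * (\<integral>\<^sup>+ r. h ((0 + 2 * r) / 2) * indicator {0<..<t} (0 + 2 * r) \<partial>lborel)"
    by (rule nn_integral_real_affine) auto
  also have "\<dots> = 2 * (\<integral>\<^sup>+ r \<in> {0<..<t / 2}. h r \<partial>lborel)"
    by (auto intro!: arg_cong2[where f = times] nn_integral_cong split: split_indicator)
  finally show ?thesis .
qed

lemma rearrangement_diff_add_le:
  assumes f0_vanishing: "f0 \<in> vanishing M" and f1_vanishing: "f1 \<in> vanishing M"
    and decomposition: "decomposes M f f0 f1"
    and r_bounds: "0 < r" "r < t"
  shows "rearrangement M f r - rearrangement M f t \<le>
      rearrangement M f0 (r / 2) + rearrangement M f0 t +
      (rearrangement M f1 (r / 2) - rearrangement M f1 (2 * t))"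
proof -
  let ?R = "rearrangement M"
  have f_vanishing: "f \<in> vanishing M"
    by (rule vanishing_add[OF f0_vanishing f1_vanishing decomposition])
  note [measurable] = f_vanishing f0_vanishing f1_vanishing
  have "decomposes M f1 f (\<lambda>x. - f0 x)" using decomposition by (simp add: decomposes_def)
  then have f1_shift_le: "?R f1 (2 * t) \<le> ?R f t + ?R f0 t"
    using rearrangement_add_le[of f M "\<lambda>x. - f0 x" f1 t t] r_bounds
    by (simp add: rearrangement_uminus)
  have "?R f r \<le> ?R f0 (r / 2) + ?R f1 (r / 2)"
    using rearrangement_add_le[OF _ _ decomposition, of "r / 2" "r / 2"] r_bounds by simp
  also have "?R f1 (r / 2) = ?R f1 (2 * t) + (?R f1 (r / 2) - ?R f1 (2 * t))"
    using r_bounds by (intro ennreal_ineq_diff_add rearrangement_mono) auto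
  also have "\<dots> \<le> (?R f t + ?R f0 t) + (?R f1 (r / 2) - ?R f1 (2 * t))"
    by (intro add_right_mono f1_shift_le)
  finally have "?R f r \<le> ?R f t + (?R f0 (r / 2) + ?R f0 t + (?R f1 (r / 2) - ?R f1 (2 * t)))"
    by (simp add: add_ac add_left_mono)
  then show ?thesis
    using rearrangement_less_top[OF f_vanishing, of t] r_bounds by (auto simp: ennreal_minus_le_iff)
qed

lemma osc_mass_add_le:
  assumes "f0 \<in> vanishing M" "f1 \<in> vanishing M" "decomposes M f f0 f1" and t_pos: "0 < t"
  shows "osc_mass M f t \<le> 3 * rearrangement_mass M f0 t + 2 * osc_mass M f1 (2 * t)"
proof -
  let ?R = "rearrangement M"
  have "osc_mass M f t \<le>
      (\<integral>\<^sup>+ r. ?R f0 (r / 2) * indicator {0<..<t} r + ?R f0 t * indicator {0<..<t} r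
      + (?R f1 (r / 2) - ?R f1 (2 * t)) * indicator {0<..<t} r \<partial>lborel)"
    unfolding osc_mass_def using rearrangement_diff_add_le[OF assms(1-3)]
    by (intro nn_integral_mono) (auto split: split_indicator)
  also have "\<dots> = (\<integral>\<^sup>+ r \<in> {0<..<t}. ?R f0 (r / 2) \<partial>lborel) + (\<integral>\<^sup>+ r \<in> {0<..<t}. ?R f0 t \<partial>lborel)
      + (\<integral>\<^sup>+ r \<in> {0<..<t}. (?R f1 (r / 2) - ?R f1 (2 * t)) \<partial>lborel)"
    by (simp add: nn_integral_add)
  also have "\<dots> = 2 * rearrangement_mass M f0 (t / 2) + ennreal t * ?R f0 t
      + 2 * (\<integral>\<^sup>+ r \<in> {0<..<t / 2}. (?R f1 r - ?R f1 (2 * t)) \<partial>lborel)"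
    using t_pos
    by (simp add: nn_integral_half_dilation[of "?R f0"] rearrangement_mass_def
      nn_integral_lborel_const_Ioo
      nn_integral_half_dilation[of "\<lambda>r. ?R f1 r - ?R f1 (2 * t)"])
  also have "\<dots> \<le>
      2 * rearrangement_mass M f0 t + rearrangement_mass M f0 t + 2 * osc_mass M f1 (2 * t)"
  proof (intro add_mono mult_left_mono)
    show "rearrangement_mass M f0 (t / 2) \<le> rearrangement_mass M f0 t"
      using t_pos by (intro monoD[OF mono_rearrangement_mass]) auto
    show "ennreal t * ?R f0 t \<le> rearrangement_mass M f0 t" by (rule rearrangement_le_mass[OF t_pos])
    show "(\<integral>\<^sup>+ r \<in> {0<..<t / 2}. (?R f1 r - ?R f1 (2 * t)) \<partial>lborel) \<le> osc_mass M f1 (2 * t)"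
      unfolding osc_mass_def using t_pos by (intro nn_integral_mono) (auto split: split_indicator)
  qed auto
  also have "2 * rearrangement_mass M f0 t + rearrangement_mass M f0 t =
      3 * rearrangement_mass M f0 t"
    using distrib_right[of 2 1 "rearrangement_mass M f0 t"] by simp
  finally show ?thesis .
qed

lemma ennreal_diff_diff_same:
  fixes a b c :: ennreal
  assumes "b < \<infinity>" "c < \<infinity>"
  shows "(a - c) - (b - c) = a - max b c"
  using assms by (cases a; cases b; cases c)
    (auto simp: ennreal_minus ennreal_neg max_def ennreal_top_minus)

lemma osc_mass_diff_truncation:
  assumes f_vanishing: "f \<in> vanishing M"
    and rearrangement_f0_eq: "\<And>s. rearrangement M f0 s = rearrangement M f s - rearrangement M f t"
    and "0 < t" "0 < s"
  shows "osc_mass M f0 s = osc_mass M f (min s t)"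
  unfolding osc_mass_def rearrangement_f0_eq
proof (rule nn_integral_cong)
  fix r
  let ?R = "rearrangement M f"
  have "max (?R s) (?R t) = ?R (min s t)"
    using rearrangement_mono[of s t M f] rearrangement_mono[of t s M f]
    by (auto simp: max_def min_def)
  then have "(?R r - ?R t) - (?R s - ?R t) = ?R r - ?R (min s t)"
    using rearrangement_less_top[OF f_vanishing] \<open>0 < t\<close> \<open>0 < s\<close>
    by (simp add: ennreal_diff_diff_same)
  moreover have "?R r - ?R (min s t) = 0" if "min s t \<le> r"
    using that rearrangement_less_top[OF f_vanishing, of "min s t"] \<open>0 < t\<close> \<open>0 < s\<close>
      rearrangement_mono[OF that] by (intro diff_eq_0_ennreal) (auto intro: le_less_trans)
  ultimately show "(?R r - ?R t - (?R s - ?R t)) * indicator {0<..<s} r =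
      (?R r - ?R (min s t)) * indicator {0<..<min s t} r"
    by (auto split: split_indicator)
qed

lemma osc_mass_truncation_le:
  assumes rearrangement_f1_eq: "\<And>s. rearrangement M f1 s =
      min (rearrangement M f t) (rearrangement M f s)"
    and finite_rearrangement: "rearrangement M f t < \<infinity>"
  shows "osc_mass M f1 s \<le> (if s \<le> t then 0 else osc_mass M f s)"
proof (cases "s \<le> t")
  case True
  have "rearrangement M f1 r = rearrangement M f t" if "r \<le> t" for r
    using rearrangement_mono[OF that, of M f] by (simp add: rearrangement_f1_eq min_def)
  then have "osc_mass M f1 s = (\<integral>\<^sup>+ r. 0 \<partial>(lborel :: real measure))"
    unfolding osc_mass_def using True finite_rearrangement
    by (intro nn_integral_cong) (auto split: split_indicator)
  then show ?thesis using True by simp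
next
  case False
  then have "rearrangement M f s \<le> rearrangement M f t" by (intro rearrangement_mono) auto
  then have "osc_mass M f1 s \<le> osc_mass M f s"
    unfolding osc_mass_def rearrangement_f1_eq
    by (intro nn_integral_mono)
      (auto split: split_indicator simp: min_absorb2 intro: ennreal_minus_mono)
  with False show ?thesis by simp
qed

section \<open>The spaces as weighted Lebesgue norms\<close>

lemma Lp_norm_osc_mass_eq:
  assumes p_pos: "0 < p" and weight_w: "weight w" and f_vanishing: "f \<in> vanishing M"
    and A_subset: "A \<in> sets borel" "A \<subseteq> {0<..}"
  shows "enn_powr (\<integral>\<^sup>+ s \<in> A. enn_powr (osc M f s) p * w s \<partial>lebesgue) (1 / p) =
    Lp_norm p (weight_measure p w) A (osc_mass M f)"
proof -
  have "enn_powr (osc M f s) p * w s = enn_powr (osc_mass M f s) p * (ennreal (s powr - p) * w s)"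
    if "0 < s" for s
  proof -
    have "osc M f s = osc_mass M f s * ennreal (1 / s)"
      using osc_eq[OF that rearrangement_less_top[OF f_vanishing that]] that
      by (simp add: divide_ennreal_def inverse_ennreal inverse_eq_divide)
    then show ?thesis
      using that p_pos
      by (simp add: enn_powr_mult enn_powr_ennreal powr_divide powr_minus_divide mult_ac)
  qed
  then have "(\<integral>\<^sup>+ s \<in> A. enn_powr (osc M f s) p * w s \<partial>lebesgue) =
      (\<integral>\<^sup>+ s \<in> A. enn_powr (osc_mass M f s) p \<partial>weight_measure p w)"
    using A_subset
    by (subst nn_integral_weight_measure[OF weight_w])
      (auto intro!: nn_integral_cong split: split_indicator)
  then show ?thesis by (simp add: Lp_norm_def)
qed

lemma S_norm_eq:
  "0 < p \<Longrightarrow> weight w \<Longrightarrow> f \<in> vanishing M \<Longrightarrow>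
    S_norm M p w f = Lp_norm p (weight_measure p w) {0<..} (osc_mass M f)"
  unfolding S_norm_def by (rule Lp_norm_osc_mass_eq) auto

lemma S_space_iff: "f \<in> S_space M p w \<longleftrightarrow> f \<in> vanishing M \<and> S_norm M p w f < \<infinity>"
  by (auto simp: S_space_def vanishing_def)

lemma sum_space_vanishing: "f \<in> sum_space M (S_space M p0 w0) (S_space M p1 w1) \<Longrightarrow> f \<in> vanishing M"
  by (auto simp: sum_space_def S_space_iff intro: vanishing_add)

lemma RB_rearrangement_mass_le:
  assumes p_pos: "0 < p" and weight_w: "weight w" and RB: "RB p w"
  obtains B :: ennreal where "B < \<infinity>"
    "\<And>(M :: 'a measure) f. f \<in> vanishing M \<Longrightarrow>
      Lp_norm p (weight_measure p w) {0<..} (rearrangement_mass M f) \<le> B * S_norm M p w f"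
proof -
  let ?\<nu> = "weight_measure p w"
  interpret diffuse_borel_measure ?\<nu> by (rule diffuse_weight_measure[OF weight_w])
  obtain B where B_finite: "B < \<infinity>" and hardy:
    "\<And>G H. mono G \<Longrightarrow> (\<And>s. 0 < s \<Longrightarrow> ennreal s * H s \<le> ennreal s * H (2 * s) + G (2 * s)) \<Longrightarrow>
      (H \<longlongrightarrow> 0) at_top \<Longrightarrow> Lp_norm p ?\<nu> {0<..} (\<lambda>s. ennreal s * H s) \<le> B * Lp_norm p ?\<nu> {0<..} G"
    using RB_measure_imp_hardy_dyadic[OF p_pos RB_imp_RB_measure[OF weight_w RB]] by blast
  define c where "c = ennreal (2 * 2 powr (1 / p))"
  show ?thesis
  proof (rule that)
    show "c * (1 + B) < \<infinity>" using B_finite by (simp add: c_def ennreal_mult_less_top)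
    fix M :: "'a measure" and f assume f_vanishing: "f \<in> vanishing M"
    let ?G = "osc_mass M f"
    have "Lp_norm p ?\<nu> {0<..} (rearrangement_mass M f) \<le>
        Lp_norm p ?\<nu> {0<..} (\<lambda>s. ?G s + ennreal s * rearrangement M f s)"
      using p_pos rearrangement_mass_le by (intro Lp_norm_mono) auto
    also have "\<dots> \<le>
        c * (Lp_norm p ?\<nu> {0<..} ?G + Lp_norm p ?\<nu> {0<..} (\<lambda>s. ennreal s * rearrangement M f s))"
      unfolding c_def using p_pos by (intro Lp_norm_add_le) auto
    also have "\<dots> \<le> c * (Lp_norm p ?\<nu> {0<..} ?G + B * Lp_norm p ?\<nu> {0<..} ?G)"
      by (intro mult_left_mono add_left_mono hardy mono_osc_mass rearrangement_doubling_le
        vanishing_tendsto[OF f_vanishing]) auto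
    also have "\<dots> = c * (1 + B) * S_norm M p w f"
      using p_pos weight_w f_vanishing
      by (simp add: S_norm_eq distrib_left distrib_right mult.assoc)
    finally show "Lp_norm p ?\<nu> {0<..} (rearrangement_mass M f) \<le> c * (1 + B) * S_norm M p w f" .
  qed
qed

section \<open>Equivalence up to constants\<close>

lemma equivalent_onI:
  assumes "A < \<infinity>" "B < \<infinity>" "\<And>x. x \<in> S \<Longrightarrow> g x \<le> A * h x" "\<And>x. x \<in> S \<Longrightarrow> h x \<le> B * g x"
  shows "equivalent_on S g h"
proof -
  define C where "C = enn2real (A + B) + 1"
  have C_bounds: "0 < C" "A \<le> ennreal C" "B \<le> ennreal C"
    using assms(1,2)
    by (auto simp: C_def less_top add_nonneg_pos intro: add_increasing add_increasing2)
  have "g x \<le> ennreal C * h x \<and> h x \<le> ennreal C * g x" if "x \<in> S" for x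
    using assms(3,4)[OF that] C_bounds(2,3) by (meson mult_right_mono order_trans zero_le)
  with C_bounds(1) show ?thesis unfolding equivalent_on_def by blast
qed

lemma equivalent_on_mono_imp_quasi_mono:
  assumes "equivalent_on A g h" "mono_on A h"
  obtains K :: real where "0 < K" "\<And>s t. s \<in> A \<Longrightarrow> t \<in> A \<Longrightarrow> s \<le> t \<Longrightarrow> g s \<le> ennreal K * g t"
proof -
  obtain C :: real where C_pos: "0 < C" and g_le_h: "\<And>x. x \<in> A \<Longrightarrow> g x \<le> ennreal C * h x"
    and h_le_g: "\<And>x. x \<in> A \<Longrightarrow> h x \<le> ennreal C * g x"
    using assms(1) unfolding equivalent_on_def by blast
  show ?thesis
  proof (rule that)
    show "0 < C * C" using C_pos by simp
    fix s t assume s_le_t: "s \<in> A" "t \<in> A" "s \<le> t"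
    have "g s \<le> ennreal C * h s" using s_le_t by (intro g_le_h)
    also have "\<dots> \<le> ennreal C * h t"
      using s_le_t by (intro mult_left_mono mono_onD[OF assms(2)]) auto
    also have "\<dots> \<le> ennreal C * (ennreal C * g t)" using s_le_t by (intro mult_left_mono h_le_g) auto
    finally show "g s \<le> ennreal (C * C) * g t" using C_pos by (simp add: ennreal_mult_mult)
  qed
qed

section \<open>Comparison with the function psi\<close>

lemma psi_antimono:
  assumes "0 < p" "s \<le> t"
  shows "psi p w t \<le> psi p w s"
  unfolding psi_def using assms
  by (intro enn_powr_mono nn_integral_mono) (auto split: split_indicator)

lemma borel_measurable_psi: "0 < p \<Longrightarrow> psi p w \<in> borel_measurable borel"
  by (intro borel_measurable_ennreal_antimono antimonoI psi_antimono)

lemma psi_pos: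
  fixes C :: real
  assumes psi_tendsto: "(psi p w \<longlongrightarrow> \<infinity>) (at_right 0)"
    and doubling: "\<And>t. 0 < t \<Longrightarrow> psi p w t \<le> ennreal C * psi p w (2 * t)" and t_pos: "0 < t"
  shows "0 < psi p w t"
proof (rule ccontr)
  assume "\<not> 0 < psi p w t"
  have "psi p w (t / 2 ^ n) = 0" for n
  proof (induction n)
    case (Suc n)
    then show ?case using doubling[of "t / 2 ^ Suc n"] t_pos by simp
  qed (use \<open>\<not> 0 < psi p w t\<close> in simp)
  moreover have "filterlim (\<lambda>n. t / 2 ^ n) (at_right 0) sequentially"
    using t_pos by (intro tendsto_imp_filterlim_at_right LIMSEQ_divide_realpow_zero) auto
  ultimately have "(\<lambda>n. 0 :: ennreal) \<longlonglongrightarrow> \<infinity>"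
    using filterlim_compose[OF psi_tendsto] by fastforce
  then show False by (simp add: LIMSEQ_const_iff)
qed

lemma tail_weight_measure_eq:
  assumes "0 < p" "weight w" "0 < t"
  shows "emeasure (weight_measure p w) {t<..} = enn_powr (psi p w t) p"
  using assms by (simp add: psi_eq)

lemma mono_mult_psi_le_Lp_norm:
  assumes mono_F: "mono F" and p_pos: "0 < p" and weight_w: "weight w" and t_pos: "0 < t"
  shows "F t * psi p w t \<le> Lp_norm p (weight_measure p w) {t<..} F"
  unfolding psi_eq[OF weight_w t_pos]
  by (intro diffuse_borel_measure.mono_mult_tail_le_Lp_norm diffuse_weight_measure weight_w mono_F
    p_pos)

lemma mono_mult_psi_le_Lp_norm_Ioi:
  assumes mono_F: "mono F" and p_pos: "0 < p" and weight_w: "weight w" and t_pos: "0 < t"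
  shows "F t * psi p w t \<le> Lp_norm p (weight_measure p w) {0<..} F"
  using t_pos
  by (intro order_trans[OF mono_mult_psi_le_Lp_norm[OF assms] Lp_norm_mono_set] p_pos) auto

lemma mono_eq_0_of_Lp_norm_eq_0:
  assumes "mono F" "0 < p" "weight w" "0 < s" "0 < psi p w s"
    and "Lp_norm p (weight_measure p w) {0<..} F = 0"
  shows "F s = 0"
  using mono_mult_psi_le_Lp_norm_Ioi[OF assms(1-4)] assms(5,6) by auto

lemma mono_eq_0_of_psi_top:
  assumes "mono F" "0 < p" "weight w" "0 < s" "psi p w s = \<infinity>"
    and "Lp_norm p (weight_measure p w) {0<..} F < \<infinity>"
  shows "F s = 0"
  using mono_mult_psi_le_Lp_norm_Ioi[OF assms(1-4)] assms(5,6)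
  by (auto simp: ennreal_mult_top top_unique split: if_splits)

lemma ennreal_le_mult_inverse:
  fixes b :: real
  assumes "x * ennreal b \<le> y" "0 < b"
  shows "x \<le> y * ennreal (1 / b)"
proof -
  have "x = x * ennreal b * ennreal (1 / b)"
    using \<open>0 < b\<close> by (simp add: mult.assoc flip: ennreal_mult)
  also have "\<dots> \<le> y * ennreal (1 / b)"
    using assms by (intro mult_right_mono) auto
  finally show ?thesis .
qed

lemma ennreal_pos_mult_top: "0 < c \<Longrightarrow> ennreal c * top = top"
  by (simp add: ennreal_mult_top)

lemma ennreal_mult_add_mult_le: "u * a + v * b \<le> (u + v) * (a + b)" for u v a b :: ennreal
  unfolding distrib_left distrib_right
  by (intro add_mono) (auto intro: add_increasing add_increasing2)

section \<open>Truncation\<close>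

lemma truncation_decomposition:
  assumes f_vanishing: "f \<in> vanishing M" and t_pos: "0 < t"
  obtains f0 f1 where "f0 \<in> vanishing M" "f1 \<in> vanishing M" "decomposes M f f0 f1"
    "\<And>s. 0 < s \<Longrightarrow> osc_mass M f0 s = osc_mass M f (min s t)"
    "\<And>s. osc_mass M f1 s \<le> (if s \<le> t then 0 else osc_mass M f s)"
proof -
  note [measurable] = f_vanishing
  define c where "c = enn2real (rearrangement M f t)"
  have c_eq: "0 \<le> c" "ennreal c = rearrangement M f t"
    using rearrangement_less_top[OF f_vanishing t_pos] by (auto simp: c_def)
  define f1 where "f1 x = max (- c) (min c (f x))" for x
  define f0 where "f0 x = f x - f1 x" for x
  have [measurable]: "f1 \<in> borel_measurable M" unfolding f1_def by measurable
  then have [measurable]: "f0 \<in> borel_measurable M" unfolding f0_def by measurable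
  have rearrangement_f0_eq: "rearrangement M f0 s = rearrangement M f s - rearrangement M f t" for s
    unfolding c_eq(2)[symmetric] using c_eq(1)
    by (intro rearrangement_diff_truncation) (auto simp: f0_def f1_def)
  have rearrangement_f1_eq: "rearrangement M f1 s = min (rearrangement M f t) (rearrangement M f s)"
    for s
    unfolding c_eq(2)[symmetric] using c_eq(1)
    by (intro rearrangement_truncation) (auto simp: f1_def)
  show ?thesis
  proof (rule that)
    show "f0 \<in> vanishing M" "f1 \<in> vanishing M"
      by (rule vanishing_of_rearrangement_le[OF f_vanishing];
        simp add: rearrangement_f0_eq rearrangement_f1_eq)+
    show "decomposes M f f0 f1" by (simp add: decomposes_def f0_def)
    show "osc_mass M f0 s = osc_mass M f (min s t)" if "0 < s" for s
      by (rule osc_mass_diff_truncation[OF f_vanishing rearrangement_f0_eq t_pos that])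
    show "osc_mass M f1 s \<le> (if s \<le> t then 0 else osc_mass M f s)" for s
      by (rule osc_mass_truncation_le[OF rearrangement_f1_eq
        rearrangement_less_top[OF f_vanishing t_pos]])
  qed
qed

lemma (in diffuse_borel_measure) Lp_norm_min_le:
  assumes [measurable]: "F \<in> borel_measurable borel" and p_pos: "0 < p" and t_pos: "0 < t"
  shows "Lp_norm p \<nu> {0<..} (\<lambda>s. F (min s t)) \<le>
    ennreal (2 powr (1 / p)) *
      (Lp_norm p \<nu> {0<..<t} F + F t * enn_powr (emeasure \<nu> {t<..}) (1 / p))"
proof -
  have "{0<..} = {0<..<t} \<union> {t..}" using t_pos by auto
  then have "Lp_norm p \<nu> {0<..} (\<lambda>s. F (min s t)) \<le> ennreal (2 powr (1 / p)) *
      (Lp_norm p \<nu> {0<..<t} (\<lambda>s. F (min s t)) + Lp_norm p \<nu> {t..} (\<lambda>s. F (min s t)))"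
    using Lp_norm_Un_le[of "\<lambda>s. F (min s t)" \<nu> "{0<..<t}" "{t..}" p] p_pos by simp
  also have "\<dots> \<le> ennreal (2 powr (1 / p)) * (Lp_norm p \<nu> {0<..<t} F + Lp_norm p \<nu> {t..} (\<lambda>_. F t))"
    using p_pos by (intro mult_left_mono add_mono Lp_norm_mono) auto
  finally show ?thesis
    using p_pos by (simp add: Lp_norm_const emeasure_atLeast)
qed

lemma Lp_norm_osc_mass_add_le:
  assumes f0_vanishing: "f0 \<in> vanishing M" and f1_vanishing: "f1 \<in> vanishing M"
    and decomposition: "decomposes M f f0 f1"
    and p_pos: "0 < p" and A_subset: "A \<in> sets borel" "A \<subseteq> {0<..}"
  shows "Lp_norm p (weight_measure p w) A (osc_mass M f) \<le> ennreal (2 * 2 powr (1 / p)) *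
    (3 * Lp_norm p (weight_measure p w) A (rearrangement_mass M f0)
      + 2 * Lp_norm p (weight_measure p w) A (\<lambda>s. osc_mass M f1 (2 * s)))"
proof -
  note [measurable] = A_subset(1)
  have "Lp_norm p (weight_measure p w) A (osc_mass M f) \<le>
      Lp_norm p (weight_measure p w) A
        (\<lambda>s. 3 * rearrangement_mass M f0 s + 2 * osc_mass M f1 (2 * s))"
    using A_subset
    by (intro Lp_norm_mono p_pos osc_mass_add_le f0_vanishing f1_vanishing decomposition) auto
  also have "\<dots> \<le> ennreal (2 * 2 powr (1 / p)) *
      (Lp_norm p (weight_measure p w) A (\<lambda>s. 3 * rearrangement_mass M f0 s)
        + Lp_norm p (weight_measure p w) A (\<lambda>s. 2 * osc_mass M f1 (2 * s)))"
    by (intro Lp_norm_add_le p_pos) auto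
  finally show ?thesis
    using p_pos by (simp add: Lp_norm_cmult)
qed

section \<open>The K-functional\<close>

locale S_couple =
  fixes M :: "'a measure" and p0 p1 :: real and w0 w1 :: "real \<Rightarrow> ennreal" and C \<epsilon> K :: real
  assumes p0_pos: "0 < p0" and p1_pos: "0 < p1" and weight_w0: "weight w0"
    and weight_w1: "weight w1"
    and psi0_pos: "\<And>t. 0 < t \<Longrightarrow> 0 < psi p0 w0 t"
    and psi1_pos: "\<And>t. 0 < t \<Longrightarrow> 0 < psi p1 w1 t"
    and psi1_finite: "\<And>t. 0 < t \<Longrightarrow> psi p1 w1 t < \<infinity>"
    and psi1_doubling: "\<And>t. 0 < t \<Longrightarrow> psi p1 w1 t \<le> ennreal C * psi p1 w1 (2 * t)"
    and RB: "RB p0 w0" and \<epsilon>_pos: "0 < \<epsilon>" and K_pos: "0 < K"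
    and quasi_mono: "\<And>s t. 0 < s \<Longrightarrow> s \<le> t \<Longrightarrow> theta p0 w0 p1 w1 s * enn_powr (psi p0 w0 s) \<epsilon> \<le>
      ennreal K * (theta p0 w0 p1 w1 t * enn_powr (psi p0 w0 t) \<epsilon>)"
begin

abbreviation \<theta> :: "real \<Rightarrow> ennreal" where
  "\<theta> \<equiv> theta p0 w0 p1 w1"

abbreviation \<nu>\<^sub>0 :: "real measure" where
  "\<nu>\<^sub>0 \<equiv> weight_measure p0 w0"

abbreviation \<nu>\<^sub>1 :: "real measure" where
  "\<nu>\<^sub>1 \<equiv> weight_measure p1 w1"

definition \<Psi>\<^sub>0 :: "real \<Rightarrow> real" where
  "\<Psi>\<^sub>0 t = enn2real (psi p0 w0 t)"

definition \<Psi>\<^sub>1 :: "real \<Rightarrow> real" where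
  "\<Psi>\<^sub>1 t = enn2real (psi p1 w1 t)"

definition split_norm :: "('a \<Rightarrow> real) \<Rightarrow> real \<Rightarrow> ennreal" where
  "split_norm f t =
    enn_powr (\<integral>\<^sup>+ s \<in> {0<..<t}. enn_powr (osc M f s) p0 * w0 s \<partial>lebesgue) (1 / p0)
    + \<theta> t * enn_powr (\<integral>\<^sup>+ s \<in> {t<..}. enn_powr (osc M f s) p1 * w1 s \<partial>lebesgue) (1 / p1)"

sublocale \<nu>\<^sub>0: diffuse_borel_measure \<nu>\<^sub>0
  by (rule diffuse_weight_measure[OF weight_w0])

sublocale \<nu>\<^sub>1: diffuse_borel_measure \<nu>\<^sub>1
  by (rule diffuse_weight_measure[OF weight_w1])

lemma split_norm_eq:
  assumes "f \<in> vanishing M" "0 < t"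
  shows "split_norm f t =
      Lp_norm p0 \<nu>\<^sub>0 {0<..<t} (osc_mass M f) + \<theta> t * Lp_norm p1 \<nu>\<^sub>1 {t<..} (osc_mass M f)"
  using assms p0_pos p1_pos weight_w0 weight_w1 unfolding split_norm_def
  by (subst (1 2) Lp_norm_osc_mass_eq) auto

lemma theta_mult_psi1: "0 < t \<Longrightarrow> \<theta> t * psi p1 w1 t = psi p0 w0 t"
  using psi1_pos[of t] psi1_finite[of t] unfolding theta_def by (simp add: ennreal_divide_times)

lemma theta_pos: "0 < t \<Longrightarrow> 0 < \<theta> t"
  using psi0_pos[of t] psi1_finite[of t] unfolding theta_def by (simp add: ennreal_zero_less_divide)

lemma psi1_eq: "0 < t \<Longrightarrow> psi p1 w1 t = ennreal (\<Psi>\<^sub>1 t)"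
  using psi1_finite[of t] by (simp add: \<Psi>\<^sub>1_def)

lemma Psi1_pos: "0 < t \<Longrightarrow> 0 < \<Psi>\<^sub>1 t"
  using psi1_finite[of t] psi1_pos[of t] by (simp add: \<Psi>\<^sub>1_def enn2real_positive_iff)

lemma tail1_eq: "0 < t \<Longrightarrow> emeasure \<nu>\<^sub>1 {t<..} = ennreal (\<Psi>\<^sub>1 t powr p1)"
  using p1_pos weight_w1 Psi1_pos[of t]
  by (simp add: tail_weight_measure_eq psi1_eq enn_powr_ennreal)

lemma borel_measurable_Psi [measurable]: "\<Psi>\<^sub>0 \<in> borel_measurable borel" "\<Psi>\<^sub>1 \<in> borel_measurable borel"
proof -
  note [measurable] = borel_measurable_psi[OF p0_pos] borel_measurable_psi[OF p1_pos]
  show "\<Psi>\<^sub>0 \<in> borel_measurable borel" "\<Psi>\<^sub>1 \<in> borel_measurable borel"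
    unfolding \<Psi>\<^sub>0_def \<Psi>\<^sub>1_def by measurable
qed

lemma theta_eq_top: "0 < t \<Longrightarrow> psi p0 w0 t = \<infinity> \<Longrightarrow> \<theta> t = \<infinity>"
  using psi1_finite[of t] by (auto simp: theta_def ennreal_top_divide)

lemma theta_less_top: "0 < t \<Longrightarrow> psi p0 w0 t < \<infinity> \<Longrightarrow> \<theta> t < \<infinity>"
  using theta_mult_psi1[of t] psi1_pos[of t]
  by (cases "\<theta> t") (auto simp: ennreal_top_mult split: if_splits)

lemma psi0_top_mono:
  assumes top_at_s: "0 < s" "s \<le> t" "psi p0 w0 s = \<infinity>"
  shows "psi p0 w0 t = \<infinity>"
proof (rule ccontr)
  assume "psi p0 w0 t \<noteq> \<infinity>"
  then have "ennreal K * (\<theta> t * enn_powr (psi p0 w0 t) \<epsilon>) < \<infinity>"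
    using theta_less_top[of t] top_at_s by (simp add: ennreal_mult_less_top less_top)
  moreover have "\<theta> s * enn_powr (psi p0 w0 s) \<epsilon> = \<infinity>"
    using top_at_s by (simp add: theta_eq_top)
  ultimately show False using quasi_mono[of s t] top_at_s by simp
qed

lemma psi0_finite_iff:
  assumes "0 < s" "0 < t"
  shows "psi p0 w0 s < \<infinity> \<longleftrightarrow> psi p0 w0 t < \<infinity>"
proof -
  have finite_iff: "psi p0 w0 a < \<infinity> \<longleftrightarrow> psi p0 w0 b < \<infinity>" if "0 < a" "a \<le> b" for a b
    using psi0_top_mono[OF that] le_less_trans[OF psi_antimono[OF p0_pos that(2), of w0]]
    by (metis infinity_ennreal_def less_top)
  show ?thesis
    using finite_iff[of s t] finite_iff[of t s] assms by (metis linear)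
qed

context
  assumes psi0_finite: "\<And>t. 0 < t \<Longrightarrow> psi p0 w0 t < \<infinity>"
begin

lemma psi0_eq: "0 < t \<Longrightarrow> psi p0 w0 t = ennreal (\<Psi>\<^sub>0 t)"
  using psi0_finite[of t] by (simp add: \<Psi>\<^sub>0_def)

lemma Psi0_pos: "0 < t \<Longrightarrow> 0 < \<Psi>\<^sub>0 t"
  using psi0_finite[of t] psi0_pos[of t] by (simp add: \<Psi>\<^sub>0_def enn2real_positive_iff)

lemma tail0_eq: "0 < t \<Longrightarrow> emeasure \<nu>\<^sub>0 {t<..} = ennreal (\<Psi>\<^sub>0 t powr p0)"
  using p0_pos weight_w0 Psi0_pos[of t]
  by (simp add: tail_weight_measure_eq psi0_eq enn_powr_ennreal)

lemma theta_eq: "0 < t \<Longrightarrow> \<theta> t = ennreal (\<Psi>\<^sub>0 t / \<Psi>\<^sub>1 t)"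
  using Psi0_pos[of t] Psi1_pos[of t] by (simp add: theta_def psi0_eq psi1_eq divide_ennreal)

lemma Psi_quasi_mono:
  assumes s_le_t: "0 < s" "s \<le> t"
  shows "\<Psi>\<^sub>0 s powr (1 + \<epsilon>) / \<Psi>\<^sub>1 s \<le> K * (\<Psi>\<^sub>0 t powr (1 + \<epsilon>) / \<Psi>\<^sub>1 t)"
proof -
  have t_pos: "0 < t" using s_le_t by simp
  note pos = Psi0_pos[OF s_le_t(1)] Psi1_pos[OF s_le_t(1)] Psi0_pos[OF t_pos] Psi1_pos[OF t_pos]
  have "ennreal (\<Psi>\<^sub>0 s powr (1 + \<epsilon>) / \<Psi>\<^sub>1 s) \<le> ennreal (K * (\<Psi>\<^sub>0 t powr (1 + \<epsilon>) / \<Psi>\<^sub>1 t))"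
    using quasi_mono[OF s_le_t] s_le_t(1) t_pos pos K_pos
    by (simp add: theta_eq psi0_eq enn_powr_ennreal powr_add flip: ennreal_mult)
  then show ?thesis
    using pos K_pos by (subst (asm) ennreal_le_iff) auto
qed

lemma inverse_Psi1_le:
  assumes s_le_t: "0 < s" "s \<le> t"
  shows "1 / \<Psi>\<^sub>1 s \<le> K * (\<Psi>\<^sub>0 t powr (1 + \<epsilon>) / \<Psi>\<^sub>1 t) * \<Psi>\<^sub>0 s powr - (1 + \<epsilon>)"
  using Psi_quasi_mono[OF s_le_t] Psi0_pos[OF s_le_t(1)] Psi1_pos[OF s_le_t(1)]
    Psi1_pos[OF less_le_trans[OF s_le_t]]
  by (simp only: powr_minus_divide) (simp add: field_simps)

lemma inverse_Psi0_le:
  assumes t_le_s: "0 < t" "t \<le> s" and "\<delta> = 1 / (1 + \<epsilon>)"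
  shows "1 / \<Psi>\<^sub>0 s \<le> K powr \<delta> * \<Psi>\<^sub>1 t powr \<delta> / \<Psi>\<^sub>0 t * \<Psi>\<^sub>1 s powr - \<delta>"
proof -
  have \<delta>_eq: "0 < \<delta>" "(1 + \<epsilon>) * \<delta> = 1" using \<epsilon>_pos assms(3) by auto
  have s_pos: "0 < s" using t_le_s by simp
  note pos = Psi0_pos[OF s_pos] Psi1_pos[OF s_pos] Psi0_pos[OF t_le_s(1)] Psi1_pos[OF t_le_s(1)]
  have "\<Psi>\<^sub>0 t powr (1 + \<epsilon>) * \<Psi>\<^sub>1 s \<le> K * \<Psi>\<^sub>1 t * \<Psi>\<^sub>0 s powr (1 + \<epsilon>)"
    using Psi_quasi_mono[OF t_le_s] pos by (simp add: field_simps)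
  then have "(\<Psi>\<^sub>0 t powr (1 + \<epsilon>) * \<Psi>\<^sub>1 s) powr \<delta> \<le> (K * \<Psi>\<^sub>1 t * \<Psi>\<^sub>0 s powr (1 + \<epsilon>)) powr \<delta>"
    using pos \<delta>_eq by (intro powr_mono2) auto
  then have "\<Psi>\<^sub>0 t * \<Psi>\<^sub>1 s powr \<delta> \<le> K powr \<delta> * \<Psi>\<^sub>1 t powr \<delta> * \<Psi>\<^sub>0 s"
    using pos \<delta>_eq by (simp add: powr_mult powr_powr)
  then show ?thesis
    using pos by (simp add: powr_minus field_simps)
qed

lemma Lp_norm_mono_before_le_of_finite:
  assumes mono_F: "mono F" and t_pos: "0 < t"
  shows "Lp_norm p0 \<nu>\<^sub>0 {0<..<t} F \<le>
    ennreal (K * ((1 + \<epsilon>) / \<epsilon>) powr (1 / p0)) * (\<theta> t * Lp_norm p1 \<nu>\<^sub>1 {0<..} F)"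
proof -
  define X where "X = Lp_norm p1 \<nu>\<^sub>1 {0<..} F"
  define c where "c = K * (\<Psi>\<^sub>0 t powr (1 + \<epsilon>) / \<Psi>\<^sub>1 t)"
  define d where "d = ((1 + \<epsilon>) / \<epsilon>) powr (1 / p0)"
  note pos = Psi0_pos[OF t_pos] Psi1_pos[OF t_pos]
  have cd_nonneg: "0 \<le> c" "0 \<le> d" using pos K_pos by (auto simp: c_def d_def)
  have "F s \<le> X * ennreal c * ennreal (\<Psi>\<^sub>0 s powr - (1 + \<epsilon>))" if "0 < s" "s < t" for s
  proof -
    have "F s \<le> X * ennreal (1 / \<Psi>\<^sub>1 s)"
      using mono_mult_psi_le_Lp_norm_Ioi[OF mono_F p1_pos weight_w1 \<open>0 < s\<close>] Psi1_pos[OF \<open>0 < s\<close>]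
      by (intro ennreal_le_mult_inverse) (auto simp: X_def psi1_eq[OF \<open>0 < s\<close>])
    also have "\<dots> \<le> X * ennreal (c * \<Psi>\<^sub>0 s powr - (1 + \<epsilon>))"
      unfolding c_def using that by (intro mult_left_mono ennreal_leI inverse_Psi1_le) auto
    finally show ?thesis using cd_nonneg by (simp add: ennreal_mult mult.assoc)
  qed
  then have "Lp_norm p0 \<nu>\<^sub>0 {0<..<t} F \<le>
      Lp_norm p0 \<nu>\<^sub>0 {0<..<t} (\<lambda>s. X * ennreal c * ennreal (\<Psi>\<^sub>0 s powr - (1 + \<epsilon>)))"
    by (intro Lp_norm_mono p0_pos) auto
  also have "\<dots> = X * ennreal c * Lp_norm p0 \<nu>\<^sub>0 {0<..<t} (\<lambda>s. ennreal (\<Psi>\<^sub>0 s powr - (1 + \<epsilon>)))"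
    by (intro Lp_norm_cmult p0_pos) auto
  also have "\<dots> \<le> X * ennreal c * ennreal (d * \<Psi>\<^sub>0 t powr - \<epsilon>)"
    unfolding d_def using Psi0_pos tail0_eq
    by (intro mult_left_mono \<nu>\<^sub>0.Lp_norm_tail_powr_before p0_pos \<epsilon>_pos t_pos) auto
  also have "\<dots> = X * ennreal (c * (d * \<Psi>\<^sub>0 t powr - \<epsilon>))"
    using cd_nonneg by (simp add: mult.assoc ennreal_mult)
  also have "c * (d * \<Psi>\<^sub>0 t powr - \<epsilon>) = K * d * (\<Psi>\<^sub>0 t / \<Psi>\<^sub>1 t)"
    using pos by (simp add: c_def powr_add powr_minus field_simps)
  also have "X * ennreal \<dots> = ennreal (K * d) * (\<theta> t * X)"
    using t_pos K_pos cd_nonneg pos by (subst ennreal_mult) (auto simp: theta_eq mult_ac)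
  finally show ?thesis unfolding X_def d_def .
qed

lemma Lp_norm_mono_after_le_of_finite:
  assumes mono_F: "mono F" and t_pos: "0 < t" and \<delta>_def: "\<delta> = 1 / (1 + \<epsilon>)"
  shows "\<theta> t * Lp_norm p1 \<nu>\<^sub>1 {t<..} F \<le>
    ennreal (K powr \<delta> * (1 / (1 - \<delta>)) powr (1 / p1)) * Lp_norm p0 \<nu>\<^sub>0 {0<..} F"
proof -
  have \<delta>_bounds: "0 < \<delta>" "\<delta> < 1" using \<epsilon>_pos by (auto simp: \<delta>_def)
  define X where "X = Lp_norm p0 \<nu>\<^sub>0 {0<..} F"
  define c where "c = K powr \<delta> * \<Psi>\<^sub>1 t powr \<delta> / \<Psi>\<^sub>0 t"
  define d where "d = (1 / (1 - \<delta>)) powr (1 / p1)"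
  note pos = Psi0_pos[OF t_pos] Psi1_pos[OF t_pos]
  have cd_nonneg: "0 \<le> c" "0 \<le> d" using pos by (auto simp: c_def d_def)
  have "F s \<le> X * ennreal c * ennreal (\<Psi>\<^sub>1 s powr - \<delta>)" if "t < s" for s
  proof -
    have s_pos: "0 < s" using that t_pos by simp
    have "F s \<le> X * ennreal (1 / \<Psi>\<^sub>0 s)"
      using mono_mult_psi_le_Lp_norm_Ioi[OF mono_F p0_pos weight_w0 s_pos] Psi0_pos[OF s_pos]
      by (intro ennreal_le_mult_inverse) (auto simp: X_def psi0_eq[OF s_pos])
    also have "\<dots> \<le> X * ennreal (c * \<Psi>\<^sub>1 s powr - \<delta>)"
      unfolding c_def using that t_pos
      by (intro mult_left_mono ennreal_leI inverse_Psi0_le \<delta>_def) auto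
    finally show ?thesis using cd_nonneg by (simp add: ennreal_mult mult.assoc)
  qed
  then have "Lp_norm p1 \<nu>\<^sub>1 {t<..} F \<le>
      Lp_norm p1 \<nu>\<^sub>1 {t<..} (\<lambda>s. X * ennreal c * ennreal (\<Psi>\<^sub>1 s powr - \<delta>))"
    by (intro Lp_norm_mono p1_pos) auto
  also have "\<dots> = X * ennreal c * Lp_norm p1 \<nu>\<^sub>1 {t<..} (\<lambda>s. ennreal (\<Psi>\<^sub>1 s powr - \<delta>))"
    by (intro Lp_norm_cmult p1_pos) auto
  also have "\<dots> \<le> X * ennreal c * ennreal (d * \<Psi>\<^sub>1 t powr (1 - \<delta>))"
    unfolding d_def using Psi1_pos tail1_eq
    by (intro mult_left_mono \<nu>\<^sub>1.Lp_norm_tail_powr_after p1_pos \<delta>_bounds t_pos) auto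
  finally have "\<theta> t * Lp_norm p1 \<nu>\<^sub>1 {t<..} F \<le>
      ennreal (\<Psi>\<^sub>0 t / \<Psi>\<^sub>1 t) * (X * ennreal c * ennreal (d * \<Psi>\<^sub>1 t powr (1 - \<delta>)))"
    unfolding theta_eq[OF t_pos] by (rule mult_left_mono) simp
  also have "\<dots> = X * ennreal (\<Psi>\<^sub>0 t / \<Psi>\<^sub>1 t * (c * (d * \<Psi>\<^sub>1 t powr (1 - \<delta>))))"
    using pos cd_nonneg
    by (simp add: ennreal_mult mult_ac del: times_divide_eq_left times_divide_eq_right)
  also have "\<Psi>\<^sub>0 t / \<Psi>\<^sub>1 t * (c * (d * \<Psi>\<^sub>1 t powr (1 - \<delta>))) = K powr \<delta> * d"
    using pos by (simp add: c_def powr_diff field_simps)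
  finally show ?thesis unfolding X_def d_def by (simp add: mult.commute)
qed

end

lemma Lp_norm_mono_before_le:
  assumes mono_F: "mono F" and t_pos: "0 < t"
  shows "Lp_norm p0 \<nu>\<^sub>0 {0<..<t} F \<le>
    ennreal (K * ((1 + \<epsilon>) / \<epsilon>) powr (1 / p0)) * (\<theta> t * Lp_norm p1 \<nu>\<^sub>1 {0<..} F)"
proof (cases "psi p0 w0 t < \<infinity>")
  case True
  then have "psi p0 w0 s < \<infinity>" if "0 < s" for s
    using psi0_finite_iff[OF that t_pos] by simp
  then show ?thesis by (rule Lp_norm_mono_before_le_of_finite[OF _ mono_F t_pos])
next
  case False
  then have theta_top: "\<theta> t = \<infinity>"
    using t_pos by (intro theta_eq_top) (auto simp: not_less top_unique)
  show ?thesis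
  proof (cases "Lp_norm p1 \<nu>\<^sub>1 {0<..} F = 0")
    case True
    then have "F s = 0" if "s \<in> {0<..<t}" for s
      using mono_eq_0_of_Lp_norm_eq_0[OF mono_F p1_pos weight_w1 _ psi1_pos] that by simp
    then have "Lp_norm p0 \<nu>\<^sub>0 {0<..<t} F \<le> Lp_norm p0 \<nu>\<^sub>0 {0<..<t} (\<lambda>_. 0)"
      using p0_pos by (intro Lp_norm_mono) auto
    then show ?thesis using p0_pos by (simp add: Lp_norm_const)
  next
    case False
    have "0 < K * ((1 + \<epsilon>) / \<epsilon>) powr (1 / p0)" using K_pos \<epsilon>_pos by simp
    with False show ?thesis
      by (simp only: theta_top ennreal_top_mult ennreal_pos_mult_top infinity_ennreal_def if_False
        top_greatest)
  qed
qed

lemma Lp_norm_mono_after_le: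
  assumes mono_F: "mono F" and t_pos: "0 < t" and \<delta>_def: "\<delta> = 1 / (1 + \<epsilon>)"
  shows "\<theta> t * Lp_norm p1 \<nu>\<^sub>1 {t<..} F \<le>
    ennreal (K powr \<delta> * (1 / (1 - \<delta>)) powr (1 / p1)) * Lp_norm p0 \<nu>\<^sub>0 {0<..} F"
proof (cases "psi p0 w0 t < \<infinity>")
  case True
  then have "psi p0 w0 s < \<infinity>" if "0 < s" for s
    using psi0_finite_iff[OF that t_pos] by simp
  then show ?thesis by (rule Lp_norm_mono_after_le_of_finite[OF _ mono_F t_pos \<delta>_def])
next
  case False
  show ?thesis
  proof (cases "Lp_norm p0 \<nu>\<^sub>0 {0<..} F < \<infinity>")
    case True
    have "F s = 0" if "s \<in> {t<..}" for s
    proof (rule mono_eq_0_of_psi_top[OF mono_F p0_pos weight_w0 _ _ True])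
      show "0 < s" using that t_pos by simp
      then show "psi p0 w0 s = \<infinity>"
        using psi0_finite_iff[of s t] t_pos False by (auto simp: not_less top_unique)
    qed
    then have "Lp_norm p1 \<nu>\<^sub>1 {t<..} F \<le> Lp_norm p1 \<nu>\<^sub>1 {t<..} (\<lambda>_. 0)"
      using p1_pos by (intro Lp_norm_mono) auto
    then show ?thesis using p1_pos by (simp add: Lp_norm_const)
  next
    case False
    then have "Lp_norm p0 \<nu>\<^sub>0 {0<..} F = top" by (simp add: not_less top_unique)
    moreover have "0 < K powr \<delta> * (1 / (1 - \<delta>)) powr (1 / p1)"
      using K_pos \<epsilon>_pos by (simp add: \<delta>_def)
    ultimately show ?thesis by (simp only: ennreal_pos_mult_top top_greatest)
  qed
qed

lemma S_norm_upper_truncation_le: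
  assumes f_vanishing: "f \<in> vanishing M" and t_pos: "0 < t" and f0_vanishing: "f0 \<in> vanishing M"
    and osc_f0: "\<And>s. 0 < s \<Longrightarrow> osc_mass M f0 s = osc_mass M f (min s t)"
  shows "S_norm M p0 w0 f0 \<le> ennreal (2 powr (1 / p0)) * split_norm f t"
proof -
  let ?G = "osc_mass M f"
  have "\<theta> t * (?G t * psi p1 w1 t) \<le> \<theta> t * Lp_norm p1 \<nu>\<^sub>1 {t<..} ?G"
    by (intro mult_left_mono mono_mult_psi_le_Lp_norm mono_osc_mass p1_pos weight_w1 t_pos) simp
  then have boundary: "?G t * psi p0 w0 t \<le> \<theta> t * Lp_norm p1 \<nu>\<^sub>1 {t<..} ?G"
    using theta_mult_psi1[OF t_pos] by (simp add: mult.left_commute)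
  have "S_norm M p0 w0 f0 \<le> Lp_norm p0 \<nu>\<^sub>0 {0<..} (\<lambda>s. ?G (min s t))"
    unfolding S_norm_eq[OF p0_pos weight_w0 f0_vanishing] using p0_pos
    by (intro Lp_norm_mono) (auto simp: osc_f0)
  also have "\<dots> \<le> ennreal (2 powr (1 / p0)) * (Lp_norm p0 \<nu>\<^sub>0 {0<..<t} ?G + ?G t * psi p0 w0 t)"
    unfolding psi_eq[OF weight_w0 t_pos] by (rule \<nu>\<^sub>0.Lp_norm_min_le[OF _ p0_pos t_pos]) simp
  also have "\<dots> \<le> ennreal (2 powr (1 / p0)) * split_norm f t"
    unfolding split_norm_eq[OF f_vanishing t_pos]
    by (intro mult_left_mono add_left_mono boundary) simp
  finally show ?thesis .
qed

lemma S_norm_lower_truncation_le: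
  assumes f_vanishing: "f \<in> vanishing M" and t_pos: "0 < t" and f1_vanishing: "f1 \<in> vanishing M"
    and osc_f1: "\<And>s. osc_mass M f1 s \<le> (if s \<le> t then 0 else osc_mass M f s)"
  shows "\<theta> t * S_norm M p1 w1 f1 \<le> split_norm f t"
proof -
  have "osc_mass M f1 s = 0" if "s \<notin> {t<..}" for s
    using osc_f1[of s] that by simp
  moreover have "osc_mass M f1 s \<le> osc_mass M f s" if "s \<in> {t<..}" for s
    using osc_f1[of s] that by simp
  ultimately have "S_norm M p1 w1 f1 \<le> Lp_norm p1 \<nu>\<^sub>1 {t<..} (osc_mass M f)"
    unfolding S_norm_eq[OF p1_pos weight_w1 f1_vanishing] using p1_pos
    by (intro Lp_norm_le_of_support) auto
  then show ?thesis
    unfolding split_norm_eq[OF f_vanishing t_pos] by (intro add_increasing mult_left_mono) auto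
qed

lemma S_K_functional_le_split_norm:
  assumes f_vanishing: "f \<in> vanishing M" and t_pos: "0 < t"
  shows "S_K_functional M p0 w0 p1 w1 f (\<theta> t) \<le> ennreal (2 powr (1 / p0) + 1) * split_norm f t"
proof (cases "split_norm f t < \<infinity>")
  case False
  then have "split_norm f t = top" by (simp add: not_less top_unique)
  then show ?thesis
    by (simp only: ennreal_pos_mult_top add_nonneg_pos powr_ge_zero zero_less_one top_greatest)
next
  case True
  obtain f0 f1 where f0_vanishing: "f0 \<in> vanishing M" and f1_vanishing: "f1 \<in> vanishing M"
    and decomposition: "decomposes M f f0 f1"
    and osc_parts: "\<And>s. 0 < s \<Longrightarrow> osc_mass M f0 s = osc_mass M f (min s t)"
      "\<And>s. osc_mass M f1 s \<le> (if s \<le> t then 0 else osc_mass M f s)"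
    using truncation_decomposition[OF f_vanishing t_pos] by blast
  note norm_f0 = S_norm_upper_truncation_le[OF f_vanishing t_pos f0_vanishing osc_parts(1)]
  note norm_f1 = S_norm_lower_truncation_le[OF f_vanishing t_pos f1_vanishing osc_parts(2)]
  have "f0 \<in> S_space M p0 w0"
    using f0_vanishing le_less_trans[OF norm_f0] True
    by (simp add: S_space_iff ennreal_mult_less_top)
  moreover have "f1 \<in> S_space M p1 w1"
    using f1_vanishing le_less_trans[OF norm_f1 True] theta_pos[OF t_pos]
    by (auto simp: S_space_iff ennreal_mult_less_top)
  ultimately have "S_K_functional M p0 w0 p1 w1 f (\<theta> t) \<le>
      S_norm M p0 w0 f0 + \<theta> t * S_norm M p1 w1 f1"
    unfolding S_K_functional_def using decomposition by (intro Inf_lower) auto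
  also have "\<dots> \<le> ennreal (2 powr (1 / p0)) * split_norm f t + split_norm f t"
    by (intro add_mono norm_f0 norm_f1)
  also have "\<dots> = ennreal (2 powr (1 / p0) + 1) * split_norm f t"
    by (simp add: distrib_right)
  finally show ?thesis .
qed

lemma Lp_norm_osc_mass_dilation_le:
  assumes f_vanishing: "f \<in> vanishing M"
  shows "Lp_norm p1 \<nu>\<^sub>1 {0<..} (\<lambda>s. osc_mass M f (2 * s)) \<le> ennreal C * S_norm M p1 w1 f"
  unfolding S_norm_eq[OF p1_pos weight_w1 f_vanishing]
proof (intro \<nu>\<^sub>1.Lp_norm_mono_dilation_le mono_osc_mass p1_pos)
  fix a :: real assume a_pos: "0 < a"
  have "enn_powr (psi p1 w1 (a / 2)) p1 \<le> enn_powr (ennreal C * psi p1 w1 a) p1"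
    using psi1_doubling[of "a / 2"] a_pos by (intro enn_powr_mono p1_pos) simp
  then show "emeasure \<nu>\<^sub>1 {a / 2<..} \<le> enn_powr (ennreal C) p1 * emeasure \<nu>\<^sub>1 {a<..}"
    using a_pos p1_pos weight_w1 by (simp add: tail_weight_measure_eq enn_powr_mult)
qed simp

lemma Lp_norm_before_le_S_norm_sum:
  obtains B :: ennreal where "B < \<infinity>"
    "\<And>f f0 f1 t. f0 \<in> vanishing M \<Longrightarrow> f1 \<in> vanishing M \<Longrightarrow> decomposes M f f0 f1 \<Longrightarrow> 0 < t \<Longrightarrow>
      Lp_norm p0 \<nu>\<^sub>0 {0<..<t} (osc_mass M f) \<le> B * (S_norm M p0 w0 f0 + \<theta> t * S_norm M p1 w1 f1)"
proof -
  obtain E :: ennreal where E_finite: "E < \<infinity>" and mass_le: "\<And>(M :: 'a measure) f. f \<in> vanishing M \<Longrightarrow>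
      Lp_norm p0 \<nu>\<^sub>0 {0<..} (rearrangement_mass M f) \<le> E * S_norm M p0 w0 f"
    using RB_rearrangement_mass_le[OF p0_pos weight_w0 RB, where 'a = 'a] by blast
  define e where "e = ennreal (K * ((1 + \<epsilon>) / \<epsilon>) powr (1 / p0))"
  define k where "k = ennreal (2 * 2 powr (1 / p0))"
  show ?thesis
  proof (rule that)
    show "k * (3 * E + 2 * (e * ennreal C)) < \<infinity>"
      using E_finite by (simp add: k_def e_def ennreal_mult_less_top)
    fix f f0 f1 and t :: real
    assume f0_vanishing: "f0 \<in> vanishing M" and f1_vanishing: "f1 \<in> vanishing M"
      and decomposition: "decomposes M f f0 f1" and t_pos: "0 < t"
    define a b where "a = S_norm M p0 w0 f0" and "b = S_norm M p1 w1 f1"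
    let ?N = "rearrangement_mass M f0" and ?G = "\<lambda>s. osc_mass M f1 (2 * s)"
    have mass_part_le: "Lp_norm p0 \<nu>\<^sub>0 {0<..<t} ?N \<le> E * a"
      unfolding a_def using p0_pos
      by (intro order_trans[OF Lp_norm_mono_set mass_le] f0_vanishing) auto
    have "Lp_norm p0 \<nu>\<^sub>0 {0<..<t} ?G \<le> e * (\<theta> t * Lp_norm p1 \<nu>\<^sub>1 {0<..} ?G)"
      unfolding e_def by (intro Lp_norm_mono_before_le t_pos monoI monoD[OF mono_osc_mass]) simp
    also have "\<dots> \<le> e * (\<theta> t * (ennreal C * b))"
      unfolding b_def by (intro mult_left_mono Lp_norm_osc_mass_dilation_le f1_vanishing) auto
    finally have osc_part_le: "Lp_norm p0 \<nu>\<^sub>0 {0<..<t} ?G \<le> e * (\<theta> t * (ennreal C * b))" .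
    have "Lp_norm p0 \<nu>\<^sub>0 {0<..<t} (osc_mass M f) \<le>
        k * (3 * Lp_norm p0 \<nu>\<^sub>0 {0<..<t} ?N + 2 * Lp_norm p0 \<nu>\<^sub>0 {0<..<t} ?G)"
      unfolding k_def
      by (intro Lp_norm_osc_mass_add_le f0_vanishing f1_vanishing decomposition p0_pos) auto
    also have "\<dots> \<le> k * (3 * (E * a) + 2 * (e * (\<theta> t * (ennreal C * b))))"
      by (intro mult_left_mono add_mono mass_part_le osc_part_le) auto
    also have "\<dots> = k * (3 * E * a + 2 * (e * ennreal C) * (\<theta> t * b))"
      by (simp add: mult_ac)
    also have "\<dots> \<le> k * ((3 * E + 2 * (e * ennreal C)) * (a + \<theta> t * b))"
      by (intro mult_left_mono ennreal_mult_add_mult_le) simp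
    finally show "Lp_norm p0 \<nu>\<^sub>0 {0<..<t} (osc_mass M f) \<le>
        k * (3 * E + 2 * (e * ennreal C)) * (S_norm M p0 w0 f0 + \<theta> t * S_norm M p1 w1 f1)"
      by (simp only: a_def b_def mult.assoc)
  qed
qed

lemma Lp_norm_after_le_S_norm_sum:
  obtains B :: ennreal where "B < \<infinity>"
    "\<And>f f0 f1 t. f0 \<in> vanishing M \<Longrightarrow> f1 \<in> vanishing M \<Longrightarrow> decomposes M f f0 f1 \<Longrightarrow> 0 < t \<Longrightarrow>
      \<theta> t * Lp_norm p1 \<nu>\<^sub>1 {t<..} (osc_mass M f) \<le> B * (S_norm M p0 w0 f0 + \<theta> t * S_norm M p1 w1 f1)"
proof -
  obtain E :: ennreal where E_finite: "E < \<infinity>" and mass_le: "\<And>(M :: 'a measure) f. f \<in> vanishing M \<Longrightarrow>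
      Lp_norm p0 \<nu>\<^sub>0 {0<..} (rearrangement_mass M f) \<le> E * S_norm M p0 w0 f"
    using RB_rearrangement_mass_le[OF p0_pos weight_w0 RB, where 'a = 'a] by blast
  define \<delta> where "\<delta> = 1 / (1 + \<epsilon>)"
  define e where "e = ennreal (K powr \<delta> * (1 / (1 - \<delta>)) powr (1 / p1))"
  define k where "k = ennreal (2 * 2 powr (1 / p1))"
  show ?thesis
  proof (rule that)
    show "k * (3 * (e * E) + 2 * ennreal C) < \<infinity>"
      using E_finite by (simp add: k_def e_def ennreal_mult_less_top)
    fix f f0 f1 and t :: real
    assume f0_vanishing: "f0 \<in> vanishing M" and f1_vanishing: "f1 \<in> vanishing M"
      and decomposition: "decomposes M f f0 f1" and t_pos: "0 < t"
    define a b where "a = S_norm M p0 w0 f0" and "b = S_norm M p1 w1 f1"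
    let ?N = "rearrangement_mass M f0" and ?G = "\<lambda>s. osc_mass M f1 (2 * s)"
    have "\<theta> t * Lp_norm p1 \<nu>\<^sub>1 {t<..} ?N \<le> e * Lp_norm p0 \<nu>\<^sub>0 {0<..} ?N"
      unfolding e_def by (intro Lp_norm_mono_after_le mono_rearrangement_mass t_pos \<delta>_def)
    also have "\<dots> \<le> e * (E * a)"
      unfolding a_def by (intro mult_left_mono mass_le f0_vanishing) simp
    finally have mass_part_le: "\<theta> t * Lp_norm p1 \<nu>\<^sub>1 {t<..} ?N \<le> e * (E * a)" .
    have osc_part_le: "Lp_norm p1 \<nu>\<^sub>1 {t<..} ?G \<le> ennreal C * b"
      unfolding b_def using p1_pos t_pos
      by (intro order_trans[OF Lp_norm_mono_set Lp_norm_osc_mass_dilation_le] f1_vanishing) auto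
    have "\<theta> t * Lp_norm p1 \<nu>\<^sub>1 {t<..} (osc_mass M f) \<le>
        \<theta> t * (k * (3 * Lp_norm p1 \<nu>\<^sub>1 {t<..} ?N + 2 * Lp_norm p1 \<nu>\<^sub>1 {t<..} ?G))"
      unfolding k_def using t_pos
      by (intro mult_left_mono Lp_norm_osc_mass_add_le f0_vanishing f1_vanishing decomposition
        p1_pos) auto
    also have "\<dots> = k * (3 * (\<theta> t * Lp_norm p1 \<nu>\<^sub>1 {t<..} ?N) + 2 * (\<theta> t * Lp_norm p1 \<nu>\<^sub>1 {t<..} ?G))"
      by (simp add: distrib_left mult_ac)
    also have "\<dots> \<le> k * (3 * (e * (E * a)) + 2 * (\<theta> t * (ennreal C * b)))"
      by (intro mult_left_mono add_mono mass_part_le osc_part_le) auto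
    also have "\<dots> = k * (3 * (e * E) * a + 2 * ennreal C * (\<theta> t * b))"
      by (simp add: mult_ac)
    also have "\<dots> \<le> k * ((3 * (e * E) + 2 * ennreal C) * (a + \<theta> t * b))"
      by (intro mult_left_mono ennreal_mult_add_mult_le) simp
    finally show "\<theta> t * Lp_norm p1 \<nu>\<^sub>1 {t<..} (osc_mass M f) \<le>
        k * (3 * (e * E) + 2 * ennreal C) * (S_norm M p0 w0 f0 + \<theta> t * S_norm M p1 w1 f1)"
      by (simp only: a_def b_def mult.assoc)
  qed
qed

lemma split_norm_le_S_norm_sum:
  obtains B :: ennreal where "B < \<infinity>"
    "\<And>f f0 f1 t. f0 \<in> vanishing M \<Longrightarrow> f1 \<in> vanishing M \<Longrightarrow> decomposes M f f0 f1 \<Longrightarrow> 0 < t \<Longrightarrow>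
      split_norm f t \<le> B * (S_norm M p0 w0 f0 + \<theta> t * S_norm M p1 w1 f1)"
proof -
  obtain B0 :: ennreal where B0_finite: "B0 < \<infinity>" and before:
    "\<And>f f0 f1 t. f0 \<in> vanishing M \<Longrightarrow> f1 \<in> vanishing M \<Longrightarrow> decomposes M f f0 f1 \<Longrightarrow> 0 < t \<Longrightarrow>
      Lp_norm p0 \<nu>\<^sub>0 {0<..<t} (osc_mass M f) \<le> B0 * (S_norm M p0 w0 f0 + \<theta> t * S_norm M p1 w1 f1)"
    using Lp_norm_before_le_S_norm_sum by blast
  obtain B1 :: ennreal where B1_finite: "B1 < \<infinity>" and after:
    "\<And>f f0 f1 t. f0 \<in> vanishing M \<Longrightarrow> f1 \<in> vanishing M \<Longrightarrow> decomposes M f f0 f1 \<Longrightarrow> 0 < t \<Longrightarrow>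
      \<theta> t * Lp_norm p1 \<nu>\<^sub>1 {t<..} (osc_mass M f) \<le>
        B1 * (S_norm M p0 w0 f0 + \<theta> t * S_norm M p1 w1 f1)"
    using Lp_norm_after_le_S_norm_sum by blast
  show ?thesis
  proof (rule that)
    show "B0 + B1 < \<infinity>" using B0_finite B1_finite by simp
    fix f f0 f1 and t :: real
    assume decomposition: "f0 \<in> vanishing M" "f1 \<in> vanishing M" "decomposes M f f0 f1"
      and t_pos: "0 < t"
    show "split_norm f t \<le> (B0 + B1) * (S_norm M p0 w0 f0 + \<theta> t * S_norm M p1 w1 f1)"
      unfolding split_norm_eq[OF vanishing_add[OF decomposition] t_pos] distrib_right[of B0]
      by (intro add_mono before after decomposition t_pos)
  qed
qed

lemma split_norm_le_S_K_functional:
  obtains B :: ennreal where "B < \<infinity>"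
    "\<And>f t. 0 < t \<Longrightarrow> split_norm f t \<le> B * S_K_functional M p0 w0 p1 w1 f (\<theta> t)"
proof -
  obtain B :: ennreal where B_finite: "B < \<infinity>" and sum_bound:
    "\<And>f f0 f1 t. f0 \<in> vanishing M \<Longrightarrow> f1 \<in> vanishing M \<Longrightarrow> decomposes M f f0 f1 \<Longrightarrow> 0 < t \<Longrightarrow>
      split_norm f t \<le> B * (S_norm M p0 w0 f0 + \<theta> t * S_norm M p1 w1 f1)"
    using split_norm_le_S_norm_sum by blast
  define A where "A = B + 1"
  have A_bounds: "0 < A" "A < \<infinity>" using B_finite by (auto simp: A_def add_nonneg_pos)
  show ?thesis
  proof (rule that[OF A_bounds(2)])
    fix f and t :: real assume t_pos: "0 < t"
    have "split_norm f t / A \<le> S_K_functional M p0 w0 p1 w1 f (\<theta> t)"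
      unfolding S_K_functional_def
    proof (rule Inf_greatest, safe)
      fix f0 f1 assume "f0 \<in> S_space M p0 w0" "f1 \<in> S_space M p1 w1" "decomposes M f f0 f1"
      then have "split_norm f t \<le> B * (S_norm M p0 w0 f0 + \<theta> t * S_norm M p1 w1 f1)"
        using t_pos by (intro sum_bound) (auto simp: S_space_iff)
      then have "split_norm f t \<le> A * (S_norm M p0 w0 f0 + \<theta> t * S_norm M p1 w1 f1)"
        by (rule order_trans) (intro mult_right_mono, auto simp: A_def)
      then show "split_norm f t / A \<le> S_norm M p0 w0 f0 + \<theta> t * S_norm M p1 w1 f1"
        using A_bounds by (intro divide_le_posI_ennreal) (auto simp: mult.commute)
    qed
    then have "A * (split_norm f t / A) \<le> A * S_K_functional M p0 w0 p1 w1 f (\<theta> t)"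
      by (rule mult_left_mono) simp
    then show "split_norm f t \<le> A * S_K_functional M p0 w0 p1 w1 f (\<theta> t)"
      using A_bounds by (simp add: ennreal_times_divide mult.commute[of A] mult_divide_eq_ennreal)
  qed
qed

lemma S_K_functional_equivalent:
  "equivalent_on (sum_space M (S_space M p0 w0) (S_space M p1 w1) \<times> {0<..})
    (\<lambda>(f, t). S_K_functional M p0 w0 p1 w1 f (\<theta> t)) (\<lambda>(f, t). split_norm f t)"
proof -
  obtain B :: ennreal where lower_bound: "B < \<infinity>"
    "\<And>f t. 0 < t \<Longrightarrow> split_norm f t \<le> B * S_K_functional M p0 w0 p1 w1 f (\<theta> t)"
    using split_norm_le_S_K_functional by blast
  then show ?thesis
    by (intro equivalent_onI[of "ennreal (2 powr (1 / p0) + 1)" B])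
      (auto intro: S_K_functional_le_split_norm sum_space_vanishing simp del: ennreal_plus)
qed

end

theorem theorem1p4:
  fixes M :: "'a measure"
    and p0 p1 :: real
    and w0 w1 :: "real \<Rightarrow> ennreal"
  assumes "sigma_finite_measure M" and "nonatomic M" and "0 < emeasure M (space M)"
    and "0 < p0" and "0 < p1"
    and "weight w0" and "weight w1"
    and "(psi p0 w0 \<longlongrightarrow> \<infinity>) (at_right 0)" and "(psi p1 w1 \<longlongrightarrow> \<infinity>) (at_right 0)"
    and "\<exists>C::real. C > 0 \<and> (\<forall>t>0. psi p0 w0 t \<le> ennreal C * psi p0 w0 (2 * t)
                             \<and> psi p1 w1 t \<le> ennreal C * psi p1 w1 (2 * t))"
    and "\<forall>t>0. psi p1 w1 t < \<infinity>"
    and "RB p0 w0"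
    and "\<exists>\<epsilon>::real. \<epsilon> > 0 \<and> (\<exists>h :: real \<Rightarrow> ennreal. mono_on {0<..} h \<and>
           equivalent_on {0<..} (\<lambda>t. theta p0 w0 p1 w1 t * enn_powr (psi p0 w0 t) \<epsilon>) h)"
  shows "equivalent_on (sum_space M (S_space M p0 w0) (S_space M p1 w1) \<times> {0<..})
           (\<lambda>(f, t). S_K_functional M p0 w0 p1 w1 f (theta p0 w0 p1 w1 t))
           (\<lambda>(f, t).
              enn_powr (\<integral>\<^sup>+ s \<in> {0<..<t}. enn_powr (osc M f s) p0 * w0 s \<partial>lebesgue) (1 / p0)
            + theta p0 w0 p1 w1 t *
              enn_powr (\<integral>\<^sup>+ s \<in> {t<..}. enn_powr (osc M f s) p1 * w1 s \<partial>lebesgue) (1 / p1))"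
proof -
  obtain C :: real where doubling: "\<And>t. 0 < t \<Longrightarrow> psi p0 w0 t \<le> ennreal C * psi p0 w0 (2 * t)"
    "\<And>t. 0 < t \<Longrightarrow> psi p1 w1 t \<le> ennreal C * psi p1 w1 (2 * t)"
    using assms(10) by blast
  obtain \<epsilon> :: real and h :: "real \<Rightarrow> ennreal" where \<epsilon>_pos: "0 < \<epsilon>"
    and mono_majorant: "mono_on {0<..} h"
    "equivalent_on {0<..} (\<lambda>t. theta p0 w0 p1 w1 t * enn_powr (psi p0 w0 t) \<epsilon>) h"
    using assms(13) by blast
  obtain K :: real where K_pos: "0 < K" and quasi_mono: "\<And>s t. 0 < s \<Longrightarrow> s \<le> t \<Longrightarrow>
      theta p0 w0 p1 w1 s * enn_powr (psi p0 w0 s) \<epsilon> \<le>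
      ennreal K * (theta p0 w0 p1 w1 t * enn_powr (psi p0 w0 t) \<epsilon>)"
    using equivalent_on_mono_imp_quasi_mono[OF mono_majorant(2,1)] by auto
  interpret S_couple M p0 p1 w0 w1 C \<epsilon> K
    using assms(4-7,11,12) doubling(2) \<epsilon>_pos K_pos quasi_mono
      psi_pos[OF assms(8) doubling(1)] psi_pos[OF assms(9) doubling(2)]
    by (intro S_couple.intro) auto
  show ?thesis
    using S_K_functional_equivalent by (simp only: split_norm_def)
qed

end
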